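(* Let $M$ be a smooth manifold. (1) A strongly convex Finsler metric $\tilde F$ on $M$ is of Randers type if and only if it solves a generalized Zermelo navigation problem on $M$; that is, if and only if there exist a Riemannian metric $h$ on $M$, a smooth positive function $f$ on $M$ (the ship's own speed, $f(x)=|u(x)|_h$) with $f(x)\le 1$ for all $x\in M$, and a smooth vector field $W$ on $M$ (the wind) with $|W(x)|_h<f(x)$ for all $x\in M$, such that $\tilde F$ is the solution metric of the generalized Zermelo navigation problem with data $(h,W,f)$. (2) Let $\tilde F$ be the solution metric of the generalized Zermelo navigation problem with data $(h,W,f)$ as in (1). Then $\tilde F$ is Riemannian (and then conformal to $h$, i.e. $\tilde F(x,y)=\rho(x)|y|_h$ for some positive smooth function $\rho$ on $M$) if and only if $W=0$ identically on $M$. (3) With $\tilde F$ and $(h,W,f)$ as in (2), $\tilde F$ is the background Riemannian norm up to scaling, i.e. there is a constant $c>0$ such that $\tilde F(x,y)=c\,|y|_h$ for all $x\in M$, $y\in T_xM$, if and only if $W=0$ identically on $M$ and $f$ (equivalently $h(u,u)=f^2$) is constant on $M$.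
   Context: For a Riemannian metric $h$ on $M$, write $|y|_h=\sqrt{h(y,y)}$ for $y\in T_xM$. A Finsler metric on $M$ is a continuous function $\tilde F:TM\to[0,\infty)$, smooth and positive on $TM\setminus 0$, with $\tilde F(x,cy)=c\tilde F(x,y)$ for all $c>0$ (positive homogeneity only; reversibility is not required). It is strongly convex if the matrix $g_{ij}=\tfrac12(\tilde F^2)_{y^iy^j}$ is positive definite at every $(x,y)$ with $y\neq 0$. It is Riemannian if $\tilde F(x,y)=\sqrt{a_x(y,y)}$ for some Riemannian metric $a$. It is of Randers type if $\tilde F(x,y)=\sqrt{a_x(y,y)}+b_x(y)$ for some Riemannian metric $a$ and some smooth differential 1-form $b$ on $M$ (the case $b=0$ is included). Generalized Zermelo navigation problem. The data are a triple $(h,W,f)$, where $h$ is a Riemannian metric on $M$, $f$ is a smooth positive function on $M$ with $f\le 1$, and $W$ is a smooth vector field on $M$ with $|W(x)|_h<f(x)$ for all $x$. A ship at $x$ can choose any own velocity $u\in T_xM$ with $|u|_h=f(x)$, and its resulting velocity is $v=u+W(x)$. The solution metric of the problem with data $(h,W,f)$ is the positively homogeneous function $\tilde F$ on $TM$ whose unit sphere in each $T_xM$ is $\{u+W(x): u\in T_xM,\ |u|_h=f(x)\}$. Thus $\tilde F$-length of a curve equals travel time, and the time-optimal paths are the geodesics of $\tilde F$. Explicitly, $$\tilde F(x,y)=\frac{\sqrt{[h(W,y)]^2+|y|_h^2\,(f(x)^2-|W|_h^2)}-h(W,y)}{f(x)^2-|W|_h^2}.$$ A Finsler metric is said to solve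 the generalized Zermelo navigation problem with data $(h,W,f)$ if it equals this $\tilde F$. *)

theory Defs
  imports "HOL-Analysis.Analysis"
begin

section \<open>Smooth maps between open subsets of normed spaces\<close>

text \<open>Meaningful for open \<open>S\<close> only, which is the only way it is used below.\<close>

primrec k_times_differentiable_on ::
    "nat \<Rightarrow> ('b::real_normed_vector \<Rightarrow> 'c::real_normed_vector) \<Rightarrow> 'b set \<Rightarrow> bool" where
  "k_times_differentiable_on 0 f S \<longleftrightarrow> continuous_on S f"
| "k_times_differentiable_on (Suc k) f S \<longleftrightarrow>
     (\<forall>x\<in>S. f differentiable (at x)) \<and>
     (\<forall>v. k_times_differentiable_on k (\<lambda>x. frechet_derivative f (at x) v) S)"

definition smooth_on ::
    "('b::real_normed_vector \<Rightarrow> 'c::real_normed_vector) \<Rightarrow> 'b set \<Rightarrow> bool" where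
  "smooth_on f S \<longleftrightarrow> (\<forall>k. k_times_differentiable_on k f S)"


section \<open>Smooth manifolds\<close>

text \<open>
  A chart is a pair of its domain and its coordinate map; the values of the coordinate map
  off the domain are irrelevant. Since \<^class>\<open>euclidean_space\<close> is nontrivial, the
  dimension is an arbitrary number \<open>\<ge> 1\<close>.
\<close>

type_synonym ('a, 'e) chart = "'a set \<times> ('a \<Rightarrow> 'e)"

definition chart_inv :: "('a, 'e) chart \<Rightarrow> 'e \<Rightarrow> 'a" where
  "chart_inv c = inv_into (fst c) (snd c)"

definition chart_image :: "('a, 'e) chart \<Rightarrow> 'e set" where
  "chart_image c = snd c ` fst c"

definition transition :: "('a, 'e) chart \<Rightarrow> ('a, 'e) chart \<Rightarrow> 'e \<Rightarrow> 'e" where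
  "transition c d = snd d \<circ> chart_inv c"

definition is_chart :: "'a topology \<Rightarrow> ('a, 'e::euclidean_space) chart \<Rightarrow> bool" where
  "is_chart M c \<longleftrightarrow> openin M (fst c) \<and> open (chart_image c) \<and>
     homeomorphic_map (subtopology M (fst c)) (top_of_set (chart_image c)) (snd c)"

text \<open>The atlas \<open>A\<close> is not required to be maximal.\<close>

definition smooth_manifold :: "'a topology \<Rightarrow> ('a, 'e::euclidean_space) chart set \<Rightarrow> bool" where
  "smooth_manifold M A \<longleftrightarrow>
     Hausdorff_space M \<and> second_countable M \<and>
     (\<forall>c\<in>A. is_chart M c) \<and> (\<Union>c\<in>A. fst c) = topspace M \<and>
     (\<forall>c\<in>A. \<forall>d\<in>A. smooth_on (transition c d) (snd c ` (fst c \<inter> fst d)))"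

definition smooth_fun ::
    "('a, 'e::euclidean_space) chart set \<Rightarrow> ('a \<Rightarrow> real) \<Rightarrow> bool" where
  "smooth_fun A f \<longleftrightarrow> (\<forall>c\<in>A. smooth_on (\<lambda>p. f (chart_inv c p)) (chart_image c))"


section \<open>Tangent vectors\<close>

text \<open>
  A tangent vector at \<open>x\<close> is given by its coordinate vectors \<open>v c\<close> in all charts \<open>c\<close> around
  \<open>x\<close>, related by the differentials of the transition maps. It is set to \<open>0\<close> on all other
  charts, so that it is determined by these coordinate vectors.
\<close>

type_synonym ('a, 'e) tvec = "('a, 'e) chart \<Rightarrow> 'e"

definition charts_at :: "('a, 'e) chart set \<Rightarrow> 'a \<Rightarrow> ('a, 'e) chart set" where
  "charts_at A x = {c \<in> A. x \<in> fst c}"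

definition tangent_space ::
    "('a, 'e::euclidean_space) chart set \<Rightarrow> 'a \<Rightarrow> ('a, 'e) tvec set" where
  "tangent_space A x = {v.
     (\<forall>c\<in>charts_at A x. \<forall>d\<in>charts_at A x.
        v d = frechet_derivative (transition c d) (at (snd c x)) (v c)) \<and>
     (\<forall>c. c \<notin> charts_at A x \<longrightarrow> v c = 0)}"

definition tzero :: "('a, 'e::euclidean_space) tvec" where
  "tzero = (\<lambda>c. 0)"

definition tadd :: "('a, 'e::euclidean_space) tvec \<Rightarrow> ('a, 'e) tvec \<Rightarrow> ('a, 'e) tvec" where
  "tadd u v = (\<lambda>c. u c + v c)"

definition tscale :: "real \<Rightarrow> ('a, 'e::euclidean_space) tvec \<Rightarrow> ('a, 'e) tvec" where
  "tscale r v = (\<lambda>c. r *\<^sub>R v c)"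

text \<open>The tangent vector at \<open>x\<close> with coordinate vector \<open>w\<close> in the chart \<open>c\<close>.\<close>

definition coord_vec ::
    "('a, 'e::euclidean_space) chart set \<Rightarrow> ('a, 'e) chart \<Rightarrow> 'a \<Rightarrow> 'e \<Rightarrow> ('a, 'e) tvec" where
  "coord_vec A c x w = (\<lambda>d. if d \<in> charts_at A x
     then frechet_derivative (transition c d) (at (snd c x)) w else 0)"


section \<open>Tensor fields\<close>

definition smooth_vector_field ::
    "'a topology \<Rightarrow> ('a, 'e::euclidean_space) chart set \<Rightarrow> ('a \<Rightarrow> ('a, 'e) tvec) \<Rightarrow> bool" where
  "smooth_vector_field M A W \<longleftrightarrow>
     (\<forall>x\<in>topspace M. W x \<in> tangent_space A x) \<and>
     (\<forall>c\<in>A. smooth_on (\<lambda>p. W (chart_inv c p) c) (chart_image c))"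

definition smooth_one_form ::
    "'a topology \<Rightarrow> ('a, 'e::euclidean_space) chart set \<Rightarrow> ('a \<Rightarrow> ('a, 'e) tvec \<Rightarrow> real) \<Rightarrow> bool" where
  "smooth_one_form M A b \<longleftrightarrow>
     (\<forall>x\<in>topspace M. \<forall>u\<in>tangent_space A x. \<forall>v\<in>tangent_space A x. \<forall>r.
        b x (tadd u v) = b x u + b x v \<and> b x (tscale r u) = r * b x u) \<and>
     (\<forall>c\<in>A. \<forall>w. smooth_on (\<lambda>p. b (chart_inv c p) (coord_vec A c (chart_inv c p) w))
        (chart_image c))"

definition riemannian_metric ::
    "'a topology \<Rightarrow> ('a, 'e::euclidean_space) chart set \<Rightarrow>
     ('a \<Rightarrow> ('a, 'e) tvec \<Rightarrow> ('a, 'e) tvec \<Rightarrow> real) \<Rightarrow> bool" where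
  "riemannian_metric M A h \<longleftrightarrow>
     (\<forall>x\<in>topspace M. \<forall>u\<in>tangent_space A x. \<forall>v\<in>tangent_space A x.
        h x u v = h x v u \<and>
        (\<forall>r. h x (tscale r u) v = r * h x u v) \<and>
        (\<forall>w\<in>tangent_space A x. h x (tadd u w) v = h x u v + h x w v) \<and>
        (u \<noteq> tzero \<longrightarrow> h x u u > 0)) \<and>
     (\<forall>c\<in>A. \<forall>w1 w2. smooth_on
        (\<lambda>p. h (chart_inv c p) (coord_vec A c (chart_inv c p) w1)
                               (coord_vec A c (chart_inv c p) w2)) (chart_image c))"

definition metric_norm ::
    "('a \<Rightarrow> ('a, 'e) tvec \<Rightarrow> ('a, 'e) tvec \<Rightarrow> real) \<Rightarrow> 'a \<Rightarrow> ('a, 'e) tvec \<Rightarrow> real" where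
  "metric_norm h x y = sqrt (h x y y)"


section \<open>Finsler metrics\<close>

text \<open>
  A function on the tangent bundle in the induced coordinates \<open>(p, y)\<close>, that is, on the open
  set \<open>chart_image c \<times> UNIV\<close>.
\<close>

definition local_rep ::
    "('a, 'e::euclidean_space) chart set \<Rightarrow> ('a, 'e) chart \<Rightarrow> ('a \<Rightarrow> ('a, 'e) tvec \<Rightarrow> real) \<Rightarrow>
     'e \<times> 'e \<Rightarrow> real" where
  "local_rep A c F = (\<lambda>(p, y). F (chart_inv c p) (coord_vec A c (chart_inv c p) y))"

definition finsler_metric ::
    "'a topology \<Rightarrow> ('a, 'e::euclidean_space) chart set \<Rightarrow> ('a \<Rightarrow> ('a, 'e) tvec \<Rightarrow> real) \<Rightarrow> bool" where
  "finsler_metric M A F \<longleftrightarrow>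
     (\<forall>x\<in>topspace M. \<forall>y\<in>tangent_space A x.
        F x y \<ge> 0 \<and> (y \<noteq> tzero \<longrightarrow> F x y > 0) \<and> (\<forall>c>0. F x (tscale c y) = c * F x y)) \<and>
     (\<forall>c\<in>A. continuous_on (chart_image c \<times> UNIV) (local_rep A c F) \<and>
            smooth_on (local_rep A c F) (chart_image c \<times> (- {0})))"

text \<open>
  \<open>g\<^sub>i\<^sub>j(p, y) = (F\<^sup>2)\<^sub>y\<^sub>i\<^sub>y\<^sub>j / 2\<close>; the indices \<open>i\<close>, \<open>j\<close> range over the standard basis vectors,
  and differentiation in their direction is partial differentiation.
\<close>

definition fundamental_tensor ::
    "('a, 'e::euclidean_space) chart set \<Rightarrow> ('a, 'e) chart \<Rightarrow> ('a \<Rightarrow> ('a, 'e) tvec \<Rightarrow> real) \<Rightarrow>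
     'e \<Rightarrow> 'e \<Rightarrow> 'e \<Rightarrow> 'e \<Rightarrow> real" where
  "fundamental_tensor A c F p y i j =
     1/2 * frechet_derivative
       (\<lambda>z. frechet_derivative (\<lambda>z'. (local_rep A c F (p, z'))\<^sup>2) (at z) i) (at y) j"

definition strongly_convex ::
    "('a, 'e::euclidean_space) chart set \<Rightarrow> ('a \<Rightarrow> ('a, 'e) tvec \<Rightarrow> real) \<Rightarrow> bool" where
  "strongly_convex A F \<longleftrightarrow>
     (\<forall>c\<in>A. \<forall>p\<in>chart_image c. \<forall>y. y \<noteq> 0 \<longrightarrow>
        (\<forall>w. w \<noteq> 0 \<longrightarrow>
           (\<Sum>i\<in>Basis. \<Sum>j\<in>Basis.
              fundamental_tensor A c F p y i j * (w \<bullet> i) * (w \<bullet> j)) > 0))"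

definition is_riemannian ::
    "'a topology \<Rightarrow> ('a, 'e::euclidean_space) chart set \<Rightarrow> ('a \<Rightarrow> ('a, 'e) tvec \<Rightarrow> real) \<Rightarrow> bool" where
  "is_riemannian M A F \<longleftrightarrow>
     (\<exists>a. riemannian_metric M A a \<and>
        (\<forall>x\<in>topspace M. \<forall>y\<in>tangent_space A x. F x y = sqrt (a x y y)))"

definition is_randers ::
    "'a topology \<Rightarrow> ('a, 'e::euclidean_space) chart set \<Rightarrow> ('a \<Rightarrow> ('a, 'e) tvec \<Rightarrow> real) \<Rightarrow> bool" where
  "is_randers M A F \<longleftrightarrow>
     (\<exists>a b. riemannian_metric M A a \<and> smooth_one_form M A b \<and>
        (\<forall>x\<in>topspace M. \<forall>y\<in>tangent_space A x. F x y = sqrt (a x y y) + b x y))"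


section \<open>Generalized Zermelo navigation\<close>

definition zermelo_data ::
    "'a topology \<Rightarrow> ('a, 'e::euclidean_space) chart set \<Rightarrow>
     ('a \<Rightarrow> ('a, 'e) tvec \<Rightarrow> ('a, 'e) tvec \<Rightarrow> real) \<Rightarrow> ('a \<Rightarrow> ('a, 'e) tvec) \<Rightarrow>
     ('a \<Rightarrow> real) \<Rightarrow> bool" where
  "zermelo_data M A h W f \<longleftrightarrow>
     riemannian_metric M A h \<and> smooth_vector_field M A W \<and> smooth_fun A f \<and>
     (\<forall>x\<in>topspace M. 0 < f x \<and> f x \<le> 1 \<and> metric_norm h x (W x) < f x)"

text \<open>
  Positive homogeneity and the unit spheres determine \<open>F\<close> on all tangent spaces; the explicit
  formula is derived in \<open>zermelo_solution_iff_explicit\<close> below.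
\<close>

definition zermelo_solution ::
    "'a topology \<Rightarrow> ('a, 'e::euclidean_space) chart set \<Rightarrow>
     ('a \<Rightarrow> ('a, 'e) tvec \<Rightarrow> ('a, 'e) tvec \<Rightarrow> real) \<Rightarrow> ('a \<Rightarrow> ('a, 'e) tvec) \<Rightarrow>
     ('a \<Rightarrow> real) \<Rightarrow> ('a \<Rightarrow> ('a, 'e) tvec \<Rightarrow> real) \<Rightarrow> bool" where
  "zermelo_solution M A h W f F \<longleftrightarrow>
     (\<forall>x\<in>topspace M.
        (\<forall>y\<in>tangent_space A x. \<forall>c>0. F x (tscale c y) = c * F x y) \<and>
        {y \<in> tangent_space A x. F x y = 1} =
          {tadd u (W x) | u. u \<in> tangent_space A x \<and> metric_norm h x u = f x})"


section \<open>Basic facts\<close>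

lemma transition_linear:
  assumes M: "smooth_manifold M A" and c: "c \<in> charts_at A x" and d: "d \<in> charts_at A x"
  shows "(transition c d has_derivative frechet_derivative (transition c d) (at (snd c x)))
           (at (snd c x))"
    and "linear (frechet_derivative (transition c d) (at (snd c x)))"
proof -
  have "k_times_differentiable_on (Suc 0) (transition c d) (snd c ` (fst c \<inter> fst d))"
    using assms by (simp add: smooth_manifold_def smooth_on_def charts_at_def del: k_times_differentiable_on.simps)
  moreover have "snd c x \<in> snd c ` (fst c \<inter> fst d)"
    using c d by (simp add: charts_at_def)
  ultimately have "transition c d differentiable (at (snd c x))"
    unfolding k_times_differentiable_on.simps by (rule bspec[OF conjunct1])
  then show D: "(transition c d has_derivative frechet_derivative (transition c d) (at (snd c x)))
           (at (snd c x))"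
    by (simp add: frechet_derivative_works)
  then show "linear (frechet_derivative (transition c d) (at (snd c x)))"
    by (rule has_derivative_linear)
qed

lemma tangent_space_transform:
  assumes "v \<in> tangent_space A x" "c \<in> charts_at A x" "d \<in> charts_at A x"
  shows "frechet_derivative (transition c d) (at (snd c x)) (v c) = v d"
proof -
  have "\<forall>c\<in>charts_at A x. \<forall>d\<in>charts_at A x.
      v d = frechet_derivative (transition c d) (at (snd c x)) (v c)"
    using assms(1) unfolding tangent_space_def by blast
  from this[rule_format, OF assms(2,3)] show ?thesis by (rule sym)
qed

lemma tangent_space_off:
  "v \<in> tangent_space A x \<Longrightarrow> c \<notin> charts_at A x \<Longrightarrow> v c = 0"
  unfolding tangent_space_def by blast

lemma tangent_spaceI:
  assumes "\<And>c d. c \<in> charts_at A x \<Longrightarrow> d \<in> charts_at A x \<Longrightarrow>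
      frechet_derivative (transition c d) (at (snd c x)) (v c) = v d"
    and "\<And>c. c \<notin> charts_at A x \<Longrightarrow> v c = 0"
  shows "v \<in> tangent_space A x"
  unfolding tangent_space_def by (simp add: assms)

lemma tangent_space_tadd:
  assumes "smooth_manifold M A" "u \<in> tangent_space A x" "v \<in> tangent_space A x"
  shows "tadd u v \<in> tangent_space A x"
  by (rule tangent_spaceI)
    (simp_all add: tadd_def linear_add[OF transition_linear(2)[OF assms(1)]]
      tangent_space_transform[OF assms(2)] tangent_space_transform[OF assms(3)]
      tangent_space_off[OF assms(2)] tangent_space_off[OF assms(3)])

lemma tangent_space_tscale:
  assumes "smooth_manifold M A" "u \<in> tangent_space A x"
  shows "tscale r u \<in> tangent_space A x"
  by (rule tangent_spaceI)
    (simp_all add: tscale_def linear_cmul[OF transition_linear(2)[OF assms(1)]]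
      tangent_space_transform[OF assms(2)] tangent_space_off[OF assms(2)])

lemma tzero_tangent_space:
  assumes "smooth_manifold M A" shows "tzero \<in> tangent_space A x"
  by (rule tangent_spaceI) (simp_all add: tzero_def linear_0[OF transition_linear(2)[OF assms]])

lemma is_chart_inj: "is_chart M c \<Longrightarrow> inj_on (snd c) (fst c)"
proof -
  assume c: "is_chart M c"
  then have "topspace (subtopology M (fst c)) = fst c"
    using openin_subset[of M "fst c"] by (auto simp: is_chart_def)
  then show ?thesis
    using c homeomorphic_imp_injective_map unfolding is_chart_def by force
qed

lemma chart_inv_chart: "is_chart M c \<Longrightarrow> x \<in> fst c \<Longrightarrow> chart_inv c (snd c x) = x"
  by (simp add: chart_inv_def is_chart_inj)

lemma overlap_open:
  assumes "is_chart M c" "is_chart M d"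
  shows "open (snd c ` (fst c \<inter> fst d))"
proof -
  have "openin (subtopology M (fst c)) (fst c \<inter> fst d)"
    using assms by (simp add: is_chart_def openin_subtopology_Int2)
  then have "openin (top_of_set (chart_image c)) (snd c ` (fst c \<inter> fst d))"
    using homeomorphic_imp_open_map[of "subtopology M (fst c)"] assms(1)
    unfolding is_chart_def open_map_def by blast
  then show ?thesis
    using assms(1) unfolding is_chart_def by (blast intro: openin_open_trans)
qed

lemma transition_derivative_compose:
  assumes M: "smooth_manifold M A"
    and c: "c \<in> charts_at A x" and d: "d \<in> charts_at A x" and e: "e \<in> charts_at A x"
  shows "frechet_derivative (transition c e) (at (snd c x)) w =
     frechet_derivative (transition d e) (at (snd d x))
       (frechet_derivative (transition c d) (at (snd c x)) w)"
proof -
  let ?S = "snd c ` (fst c \<inter> fst d)"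
  have ch: "is_chart M c" "is_chart M d"
    using M c d by (auto simp: smooth_manifold_def charts_at_def)
  have xcd: "transition c d (snd c x) = snd d x"
    using c ch by (simp add: transition_def charts_at_def chart_inv_chart)
  let ?D = "frechet_derivative (transition d e) (at (snd d x)) \<circ>
        frechet_derivative (transition c d) (at (snd c x))"
  have 1: "((transition d e \<circ> transition c d) has_derivative ?D) (at (snd c x))"
    by (rule diff_chain_at[OF transition_linear(1)[OF M c d]])
      (simp add: xcd transition_linear(1)[OF M d e])
  have 2: "(transition d e \<circ> transition c d) p = transition c e p" if "p \<in> ?S" for p
    using that ch by (auto simp: transition_def chart_inv_chart)
  have 3: "snd c x \<in> ?S"
    using c d by (simp add: charts_at_def)
  have "(transition c e has_derivative ?D) (at (snd c x))"
    by (rule has_derivative_transform_within_open[OF 1 overlap_open[OF ch] 3 2])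
  then have "?D = frechet_derivative (transition c e) (at (snd c x))"
    by (rule frechet_derivative_at)
  then show ?thesis
    by (simp add: fun_eq_iff)
qed

lemma transition_derivative_self:
  assumes M: "smooth_manifold M A" and c: "c \<in> charts_at A x"
  shows "frechet_derivative (transition c c) (at (snd c x)) w = w"
proof -
  have ch: "is_chart M c"
    using M c by (auto simp: smooth_manifold_def charts_at_def)
  have 1: "((\<lambda>p. p) has_derivative (\<lambda>p. p)) (at (snd c x))"
    by (rule has_derivative_ident)
  have 2: "p = transition c c p" if "p \<in> chart_image c" for p
    using that ch by (auto simp: transition_def chart_inv_chart chart_image_def)
  have 3: "open (chart_image c)" "snd c x \<in> chart_image c"
    using ch c by (auto simp: charts_at_def is_chart_def chart_image_def)
  have "(transition c c has_derivative (\<lambda>p. p)) (at (snd c x))"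
    by (rule has_derivative_transform_within_open[OF 1 3 2])
  then have "(\<lambda>p. p) = frechet_derivative (transition c c) (at (snd c x))"
    by (rule frechet_derivative_at)
  then show ?thesis
    by (rule fun_cong[symmetric])
qed

lemma coord_vec_bij:
  assumes M: "smooth_manifold M A" and c: "c \<in> charts_at A x"
  shows "bij_betw (coord_vec A c x) UNIV (tangent_space A x)"
proof (rule bij_betw_byWitness[where f' = "\<lambda>v. v c"])
  show "\<forall>w\<in>UNIV. coord_vec A c x w c = w"
    using c by (simp add: coord_vec_def transition_derivative_self[OF M c])
  show "\<forall>v\<in>tangent_space A x. coord_vec A c x (v c) = v"
    by (auto simp: coord_vec_def tangent_space_transform[OF _ c] tangent_space_off)
  have "coord_vec A c x w \<in> tangent_space A x" for w
    by (rule tangent_spaceI)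
      (simp_all add: coord_vec_def transition_derivative_compose[OF M c, symmetric])
  then show "range (coord_vec A c x) \<subseteq> tangent_space A x"
    by blast
qed auto

lemma zermelo_sphere_aux:
  fixes n B l :: real
  assumes "l > 0" and that: "n \<ge> 0"
  shows "(sqrt (B\<^sup>2 + n * l) - B) / l = 1 \<longleftrightarrow> n = l + 2 * B"
proof -
  have "(sqrt (B\<^sup>2 + n * l) - B) / l = 1 \<longleftrightarrow> sqrt (B\<^sup>2 + n * l) = l + B"
    using assms by (auto simp: field_simps)
  also have "\<dots> \<longleftrightarrow> n = l + 2 * B"
  proof
    assume "sqrt (B\<^sup>2 + n * l) = l + B"
    then have "B\<^sup>2 + n * l = (l + B)\<^sup>2"
      using assms real_sqrt_pow2[of "B\<^sup>2 + n * l"] by simp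
    then have "l * n = l * (l + 2 * B)"
      by (simp add: power2_eq_square algebra_simps)
    then show "n = l + 2 * B" using assms by simp
  next
    assume n: "n = l + 2 * B"
    then have "B\<^sup>2 + n * l = (l + B)\<^sup>2"
      by (simp add: power2_eq_square algebra_simps)
    moreover have "l + B \<ge> 0" using n that assms by simp
    ultimately show "sqrt (B\<^sup>2 + n * l) = l + B" by simp
  qed
  finally show ?thesis by simp
qed

definition zermelo_formula ::
    "('a \<Rightarrow> ('a, 'e::euclidean_space) tvec \<Rightarrow> ('a, 'e) tvec \<Rightarrow> real) \<Rightarrow>
     ('a \<Rightarrow> ('a, 'e) tvec) \<Rightarrow> ('a \<Rightarrow> real) \<Rightarrow> 'a \<Rightarrow> ('a, 'e) tvec \<Rightarrow> real" where
  "zermelo_formula h W f x y =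
     (sqrt ((h x (W x) y)\<^sup>2 + (metric_norm h x y)\<^sup>2 * ((f x)\<^sup>2 - (metric_norm h x (W x))\<^sup>2))
        - h x (W x) y) / ((f x)\<^sup>2 - (metric_norm h x (W x))\<^sup>2)"

theorem zermelo_solution_iff_explicit:
  fixes M :: "'a topology" and A :: "('a, 'e::euclidean_space) chart set"
  assumes M: "smooth_manifold M A" and Z: "zermelo_data M A h W f"
  shows "zermelo_solution M A h W f F \<longleftrightarrow>
    (\<forall>x\<in>topspace M. \<forall>y\<in>tangent_space A x. F x y = zermelo_formula h W f x y)"
proof -
  have "((\<forall>y\<in>tangent_space A x. \<forall>c>0. F x (tscale c y) = c * F x y) \<and>
        {y \<in> tangent_space A x. F x y = 1} =
          {tadd u (W x) | u. u \<in> tangent_space A x \<and> metric_norm h x u = f x}) \<longleftrightarrow>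
     (\<forall>y\<in>tangent_space A x. F x y = zermelo_formula h W f x y)" (is "?P \<longleftrightarrow> ?Q")
    if x: "x \<in> topspace M" for x
  proof -
    let ?T = "tangent_space A x" and ?Z = "zermelo_formula h W f x"
    let ?l = "(f x)\<^sup>2 - (metric_norm h x (W x))\<^sup>2"
    note Tadd = tangent_space_tadd[OF M] and Tscale = tangent_space_tscale[OF M]
    have R: "riemannian_metric M A h" and W: "W x \<in> ?T" and f: "0 < f x"
      and Wf: "metric_norm h x (W x) < f x"
      using Z x by (auto simp: zermelo_data_def smooth_vector_field_def)
    have sym: "h x u v = h x v u" if "u \<in> ?T" "v \<in> ?T" for u v
      using R x that by (auto simp: riemannian_metric_def)
    have scal: "h x (tscale r u) v = r * h x u v" if "u \<in> ?T" "v \<in> ?T" for r u v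
      using R x that by (auto simp: riemannian_metric_def)
    have add: "h x (tadd u w) v = h x u v + h x w v" if "u \<in> ?T" "v \<in> ?T" "w \<in> ?T" for u v w
      using R x that by (auto simp: riemannian_metric_def)
    have pos: "h x u u > 0" if "u \<in> ?T" "u \<noteq> tzero" for u
      using R x that by (auto simp: riemannian_metric_def)
    have zero: "tscale 0 u = tzero" "tscale r tzero = (tzero :: ('a, 'e) tvec)" for u :: "('a, 'e) tvec" and r
      by (auto simp: tscale_def tzero_def)
    have T0: "tzero \<in> ?T" by (rule tzero_tangent_space[OF M])
    have h0: "h x tzero v = 0" if "v \<in> ?T" for v
      using scal[OF T0 that, of 0] zero by simp
    have nonneg: "h x u u \<ge> 0" if "u \<in> ?T" for u
      using pos[OF that] h0[OF T0] by (cases "u = tzero") auto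
    have n2: "(metric_norm h x u)\<^sup>2 = h x u u" if "u \<in> ?T" for u
      using nonneg[OF that] by (simp add: metric_norm_def)
    have l: "?l > 0"
      using power_strict_mono[OF Wf, of 2] nonneg[OF W] by (simp add: metric_norm_def)
    have Zh: "?Z (tscale c y) = c * ?Z y" if y: "y \<in> ?T" and c: "c > 0" for c y
    proof -
      have 1: "h x (W x) (tscale c y) = c * h x (W x) y"
        by (simp only: sym[OF W Tscale[OF y]] scal[OF y W] sym[OF W y])
      have 2: "(metric_norm h x (tscale c y))\<^sup>2 = c\<^sup>2 * (metric_norm h x y)\<^sup>2"
      proof -
        have "h x (tscale c y) (tscale c y) = c * (c * h x y y)"
          by (simp only: scal[OF y Tscale[OF y]] sym[OF y Tscale[OF y]] scal[OF y y])
        then show ?thesis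
          unfolding n2[OF y] n2[OF Tscale[OF y]] by (simp add: power2_eq_square)
      qed
      have "(c * h x (W x) y)\<^sup>2 + c\<^sup>2 * (metric_norm h x y)\<^sup>2 * ?l
          = c\<^sup>2 * ((h x (W x) y)\<^sup>2 + (metric_norm h x y)\<^sup>2 * ?l)"
        by (simp add: power_mult_distrib algebra_simps)
      then have "sqrt ((c * h x (W x) y)\<^sup>2 + c\<^sup>2 * (metric_norm h x y)\<^sup>2 * ?l)
          = c * sqrt ((h x (W x) y)\<^sup>2 + (metric_norm h x y)\<^sup>2 * ?l)"
        using c by (simp add: real_sqrt_mult)
      then show ?thesis
        unfolding zermelo_formula_def 1 2 by (simp add: right_diff_distrib)
    qed
    have Zpos: "?Z y > 0" if y: "y \<in> ?T" "y \<noteq> tzero" for y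
    proof -
      have "(h x (W x) y)\<^sup>2 < (h x (W x) y)\<^sup>2 + (metric_norm h x y)\<^sup>2 * ?l"
        using l pos[OF y] n2[OF y(1)] by simp
      then have "\<bar>h x (W x) y\<bar> < sqrt ((h x (W x) y)\<^sup>2 + (metric_norm h x y)\<^sup>2 * ?l)"
        using real_sqrt_less_mono by (metis real_sqrt_abs)
      then show ?thesis using l by (simp add: zermelo_formula_def)
    qed
    have Z0: "?Z tzero = 0"
      using h0[OF W] h0[OF T0] sym[OF W T0] n2[OF T0] by (simp add: zermelo_formula_def)
    have sphere: "{y \<in> ?T. ?Z y = 1} =
        {tadd u (W x) | u. u \<in> ?T \<and> metric_norm h x u = f x}"
    proof -
      have key: "?Z (tadd u (W x)) = 1 \<longleftrightarrow> metric_norm h x u = f x" if u: "u \<in> ?T" for u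
      proof -
        let ?y = "tadd u (W x)"
        have y: "?y \<in> ?T" using Tadd u W by blast
        have B: "h x (W x) ?y = h x u (W x) + h x (W x) (W x)"
          using sym[OF W y] add[OF u W W] by simp
        have "h x ?y ?y = h x u ?y + h x (W x) ?y" using add[OF u y W] .
        also have "h x u ?y = h x u u + h x u (W x)"
          using sym[OF u y] add[OF u u W] sym[OF W u] by simp
        finally have N: "h x ?y ?y = h x u u + 2 * h x u (W x) + h x (W x) (W x)"
          using B by simp
        have "?Z ?y = 1 \<longleftrightarrow> h x ?y ?y = ?l + 2 * h x (W x) ?y"
          unfolding zermelo_formula_def n2[OF y]
          by (rule zermelo_sphere_aux[OF l nonneg[OF y]])
        also have "\<dots> \<longleftrightarrow> h x u u = (f x)\<^sup>2"
          unfolding N B n2[OF W] by auto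
        also have "\<dots> \<longleftrightarrow> metric_norm h x u = f x"
        proof
          show "h x u u = (f x)\<^sup>2 \<Longrightarrow> metric_norm h x u = f x"
            using f by (simp add: metric_norm_def)
          show "metric_norm h x u = f x \<Longrightarrow> h x u u = (f x)\<^sup>2"
            using n2[OF u] by simp
        qed
        finally show ?thesis .
      qed
      have "\<exists>u\<in>?T. y = tadd u (W x)" if "y \<in> ?T" for y
      proof
        show "tadd y (tscale (-1) (W x)) \<in> ?T" using Tadd Tscale that W by blast
      qed (simp add: tadd_def tscale_def)
      then show ?thesis using key Tadd W by blast
    qed
    show ?thesis
    proof
      assume P: ?P
      show ?Q
      proof
        fix y assume y: "y \<in> ?T"
        show "F x y = ?Z y"
        proof (cases "y = tzero")
          case True
          then have "F x tzero = 2 * F x tzero" using bspec[OF conjunct1[OF P] T0, rule_format, of 2] zero by simp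
          then show ?thesis using True Z0 by simp
        next
          case False
          let ?t = "?Z y" let ?y' = "tscale (1 / ?t) y"
          have t: "?t > 0" using Zpos[OF y False] .
          have "?Z ?y' = 1" using Zh[OF y, of "1 / ?t"] t by simp
          then have "?y' \<in> {y \<in> ?T. F x y = 1}" using P sphere Tscale[OF y] by blast
          moreover have "F x ?y' = 1 / ?t * F x y" using P y t by simp
          ultimately show ?thesis using t by simp
        qed
      qed
    next
      assume Q: ?Q
      then have "{y \<in> ?T. F x y = 1} = {y \<in> ?T. ?Z y = 1}" by auto
      moreover have "\<forall>y\<in>?T. \<forall>c>0. F x (tscale c y) = c * F x y"
        using Q Zh Tscale by simp
      ultimately show ?P using sphere by simp
    qed
  qed
  then show ?thesis unfolding zermelo_solution_def by blast
qed

end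

theory Submission
  imports Defs
begin

text \<open>
  In each tangent space the unit sphere of a Zermelo solution is an ellipsoid centred at the
  wind, with the origin inside, and the unit spheres of positive Randers norms are just the
  ellipsoids with the origin inside; hence the first claim. Algebraically, the explicit formula for the
  solution is \<open>\<surd>a + b\<close> with \<open>a = h / \<lambda> + \<beta> \<otimes> \<beta> / \<lambda>\<^sup>2\<close> and \<open>b = - \<beta> / \<lambda>\<close>, where \<open>\<beta> = h(W, \<cdot>)\<close>
  and \<open>\<lambda> = f\<^sup>2 - h(W, W) > 0\<close> (\<open>zermelo_solution_is_randers\<close>). Conversely, with own speed
  \<open>f = 1\<close> these equations can be solved for \<open>h\<close> and \<open>W\<close>: if \<open>B\<close> is the \<open>a\<close>-dual of \<open>b\<close>,
  then \<open>\<lambda> = 1 - a(B, B)\<close>, \<open>h = \<lambda> (a - b \<otimes> b)\<close> and \<open>W = - B / \<lambda>\<close>. That \<open>\<lambda>\<close> and \<open>h\<close> are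
  positive amounts to \<open>b\<^sup>2 < a\<close>, and this follows from the positivity of the Finsler metric
  in opposite directions (\<open>positive_randers_is_zermelo_solution\<close>).

  The analytic content is that these constructions preserve smoothness. They use field
  operations on the components of tensors, for which the calculus of smooth maps is developed
  first, and one step that is not explicit, the dual vector field of a 1-form. In coordinates
  it solves a positive definite linear system with smooth coefficients, and a Gram--Schmidt
  process without square roots shows that the solution is smooth
  (\<open>smooth_solution_on_basis_subset\<close>).

  The other claims rest on reversibility. Both a Riemannian norm and a multiple of \<open>|y|\<^sub>h\<close> take
  the same value at \<open>y\<close> and \<open>-y\<close>, whereas the solution takes the same value at \<open>W\<close> and \<open>-W\<close>
  only where \<open>W = 0\<close> (\<open>reversible_zermelo_solution_no_wind\<close>). Without wind the solution is
  \<open>|y|\<^sub>h / f\<close>, from which the conformal factor \<open>1 / f\<close> and the condition that \<open>f\<close> be constant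
  can be read off.
\<close>

section \<open>Calculus of smooth maps\<close>

lemma k_times_differentiable_on_cong:
  assumes "open S" and "\<And>x. x \<in> S \<Longrightarrow> f x = g x" and "k_times_differentiable_on k f S"
  shows "k_times_differentiable_on k g S"
  using assms(2,3)
proof (induction k arbitrary: f g)
  case 0
  then show ?case by (simp cong: continuous_on_cong)
next
  case (Suc k)
  have D: "(g has_derivative frechet_derivative f (at x)) (at x)" if x: "x \<in> S" for x
    by (rule has_derivative_transform_within_open[OF _ assms(1) x Suc.prems(1)])
      (use Suc.prems(2) x in \<open>auto simp: frechet_derivative_works\<close>)
  have E: "frechet_derivative g (at x) = frechet_derivative f (at x)" if "x \<in> S" for x
    using frechet_derivative_at[OF D[OF that]] by simp
  have "k_times_differentiable_on k (\<lambda>x. frechet_derivative g (at x) v) S" for v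
    by (rule Suc.IH[of "\<lambda>x. frechet_derivative f (at x) v"]) (use E Suc.prems(2) in auto)
  moreover have "\<forall>x\<in>S. g differentiable (at x)"
    using D by (auto simp: differentiable_def)
  ultimately show ?case by simp
qed

text \<open>The constant \<^const>\<open>frechet_derivative\<close> being a choice, any explicit derivative \<open>f'\<close> agrees
  with it by uniqueness, but on \<open>S\<close> only; this is where \<open>S\<close> has to be open.\<close>

lemma k_times_differentiable_on_SucI:
  assumes "open S" and "\<And>x. x \<in> S \<Longrightarrow> (f has_derivative f' x) (at x)"
    and "\<And>v. k_times_differentiable_on k (\<lambda>x. f' x v) S"
  shows "k_times_differentiable_on (Suc k) f S"
proof -
  have "frechet_derivative f (at x) = f' x" if "x \<in> S" for x
    using frechet_derivative_at[OF assms(2)[OF that]] by simp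
  then have "k_times_differentiable_on k (\<lambda>x. frechet_derivative f (at x) v) S" for v
    using k_times_differentiable_on_cong[OF assms(1) _ assms(3)[of v]] by simp
  then show ?thesis
    using assms(2) by (auto simp: differentiable_def)
qed

lemma k_times_differentiable_on_SucD:
  assumes "k_times_differentiable_on (Suc k) f S"
  shows "x \<in> S \<Longrightarrow> (f has_derivative frechet_derivative f (at x)) (at x)"
    and "k_times_differentiable_on k (\<lambda>x. frechet_derivative f (at x) v) S"
  using assms by (auto simp: frechet_derivative_works)

lemma k_times_differentiable_on_decrease:
  "k_times_differentiable_on (Suc k) f S \<Longrightarrow> k_times_differentiable_on k f S"
proof (induction k arbitrary: f)
  case 0
  then show ?case
    by (auto intro!: continuous_at_imp_continuous_on differentiable_imp_continuous_within)
next
  case (Suc k)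
  then show ?case by simp
qed

lemma k_times_differentiable_on_const: "open S \<Longrightarrow> k_times_differentiable_on k (\<lambda>x. a) S"
proof (induction k arbitrary: a)
  case (Suc k)
  show ?case
    by (rule k_times_differentiable_on_SucI[OF Suc.prems has_derivative_const Suc.IH[OF Suc.prems]])
qed simp

lemma k_times_differentiable_on_add:
  assumes "open S" "k_times_differentiable_on k f S" "k_times_differentiable_on k g S"
  shows "k_times_differentiable_on k (\<lambda>x. f x + g x) S"
  using assms(2,3)
proof (induction k arbitrary: f g)
  case 0
  then show ?case by (simp add: continuous_on_add)
next
  case (Suc k)
  note f = k_times_differentiable_on_SucD[OF Suc.prems(1)]
    and g = k_times_differentiable_on_SucD[OF Suc.prems(2)]
  show ?case
    by (rule k_times_differentiable_on_SucI[OF assms(1) has_derivative_add[OF f(1) g(1)]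
          Suc.IH[OF f(2) g(2)]])
qed

lemma (in bounded_bilinear) k_times_differentiable_on:
  assumes S: "open S" and "k_times_differentiable_on k f S" "k_times_differentiable_on k g S"
  shows "k_times_differentiable_on k (\<lambda>x. prod (f x) (g x)) S"
  using assms(2,3)
proof (induction k arbitrary: f g)
  case 0
  then show ?case by (simp add: continuous_on)
next
  case (Suc k)
  note f = k_times_differentiable_on_SucD[OF Suc.prems(1)]
    and g = k_times_differentiable_on_SucD[OF Suc.prems(2)]
  show ?case
    by (rule k_times_differentiable_on_SucI[OF S FDERIV[OF f(1) g(1)]
          k_times_differentiable_on_add[OF S
            Suc.IH[OF k_times_differentiable_on_decrease[OF Suc.prems(1)] g(2)]
            Suc.IH[OF f(2) k_times_differentiable_on_decrease[OF Suc.prems(2)]]]])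
qed

lemma k_times_differentiable_on_inverse:
  fixes f :: "'b::real_normed_vector \<Rightarrow> real"
  assumes S: "open S" and nz: "\<And>x. x \<in> S \<Longrightarrow> f x \<noteq> 0" and "k_times_differentiable_on k f S"
  shows "k_times_differentiable_on k (\<lambda>x. inverse (f x)) S"
  using assms(3)
proof (induction k)
  case 0
  then show ?case using nz by (simp add: continuous_on_inverse)
next
  case (Suc k)
  note f = k_times_differentiable_on_SucD[OF Suc.prems]
    and mult = bounded_bilinear.k_times_differentiable_on[OF bounded_bilinear_mult S]
    and IH = Suc.IH[OF k_times_differentiable_on_decrease[OF Suc.prems]]
  have D: "((\<lambda>x. inverse (f x)) has_derivative
      (\<lambda>v. (- 1) * (inverse (f x) * frechet_derivative f (at x) v * inverse (f x)))) (at x)"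
    if "x \<in> S" for x
    using Deriv.has_derivative_inverse[OF nz[OF that] f(1)[OF that]] by simp
  show ?case
    by (rule k_times_differentiable_on_SucI[OF S D
          mult[OF k_times_differentiable_on_const[OF S] mult[OF mult[OF IH f(2)] IH]]])
qed

lemma smooth_on_cong:
  "open S \<Longrightarrow> (\<And>x. x \<in> S \<Longrightarrow> f x = g x) \<Longrightarrow> smooth_on f S \<Longrightarrow> smooth_on g S"
  unfolding smooth_on_def by (metis k_times_differentiable_on_cong)

lemma smooth_on_const: "open S \<Longrightarrow> smooth_on (\<lambda>x. a) S"
  by (simp add: smooth_on_def k_times_differentiable_on_const)

lemma smooth_on_add:
  "open S \<Longrightarrow> smooth_on f S \<Longrightarrow> smooth_on g S \<Longrightarrow> smooth_on (\<lambda>x. f x + g x) S"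
  by (simp add: smooth_on_def k_times_differentiable_on_add)

lemma smooth_on_scaleR:
  "open S \<Longrightarrow> smooth_on f S \<Longrightarrow> smooth_on g S \<Longrightarrow> smooth_on (\<lambda>x. f x *\<^sub>R g x) S"
  by (simp add: smooth_on_def bounded_bilinear.k_times_differentiable_on[OF bounded_bilinear_scaleR])

lemma smooth_on_mult:
  fixes f g :: "'b::real_normed_vector \<Rightarrow> real"
  shows "open S \<Longrightarrow> smooth_on f S \<Longrightarrow> smooth_on g S \<Longrightarrow> smooth_on (\<lambda>x. f x * g x) S"
  using smooth_on_scaleR[of S f g] by simp

lemma smooth_on_inner_const:
  "open S \<Longrightarrow> smooth_on f S \<Longrightarrow> smooth_on (\<lambda>x. f x \<bullet> a) S"
  by (simp add: smooth_on_def k_times_differentiable_on_const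
      bounded_bilinear.k_times_differentiable_on[OF bounded_bilinear_inner])

lemma smooth_on_minus: "open S \<Longrightarrow> smooth_on f S \<Longrightarrow> smooth_on (\<lambda>x. - f x) S"
  using smooth_on_scaleR[OF _ smooth_on_const, of S f "- 1"] by simp

lemma smooth_on_diff:
  "open S \<Longrightarrow> smooth_on f S \<Longrightarrow> smooth_on g S \<Longrightarrow> smooth_on (\<lambda>x. f x - g x) S"
  using smooth_on_add[OF _ _ smooth_on_minus, of S f g] by simp

lemma smooth_on_divide:
  fixes f g :: "'b::real_normed_vector \<Rightarrow> real"
  assumes "open S" "smooth_on f S" "smooth_on g S" "\<And>x. x \<in> S \<Longrightarrow> g x \<noteq> 0"
  shows "smooth_on (\<lambda>x. f x / g x) S"
proof -
  have "smooth_on (\<lambda>x. inverse (g x)) S"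
    using assms by (simp add: smooth_on_def k_times_differentiable_on_inverse)
  from smooth_on_mult[OF assms(1,2) this] show ?thesis
    by (simp add: divide_inverse)
qed

lemma smooth_on_sum:
  assumes "open S" "\<And>i. i \<in> I \<Longrightarrow> smooth_on (f i) S"
  shows "smooth_on (\<lambda>x. \<Sum>i\<in>I. f i x) S"
  using assms(2)
  by (induction I rule: infinite_finite_induct)
    (simp_all add: smooth_on_const smooth_on_add assms(1))

section \<open>Smooth families of forms on Euclidean space\<close>

lemma smooth_on_linear_family:
  fixes L :: "'b::real_normed_vector \<Rightarrow> 'e::euclidean_space \<Rightarrow> real"
  assumes S: "open S" and lin: "\<And>p. p \<in> S \<Longrightarrow> linear (L p)"
    and L: "\<And>w. smooth_on (\<lambda>p. L p w) S" and X: "smooth_on X S"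
  shows "smooth_on (\<lambda>p. L p (X p)) S"
proof (rule smooth_on_cong[OF S])
  show "smooth_on (\<lambda>p. \<Sum>i\<in>Basis. (X p \<bullet> i) * L p i) S"
    by (intro smooth_on_sum smooth_on_mult smooth_on_inner_const S X L)
  show "(\<Sum>i\<in>Basis. (X p \<bullet> i) * L p i) = L p (X p)" if "p \<in> S" for p
  proof -
    have "L p (X p) = L p (\<Sum>i\<in>Basis. (X p \<bullet> i) *\<^sub>R i)"
      by (simp add: euclidean_representation)
    then show ?thesis
      by (simp add: linear_sum[OF lin[OF that]] linear_cmul[OF lin[OF that]])
  qed
qed

lemma smooth_on_bilinear_family:
  fixes G :: "'b::real_normed_vector \<Rightarrow> 'e::euclidean_space \<Rightarrow> 'e \<Rightarrow> real"
  assumes S: "open S" and bil: "\<And>p. p \<in> S \<Longrightarrow> bilinear (G p)"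
    and G: "\<And>v w. smooth_on (\<lambda>p. G p v w) S" and X: "smooth_on X S" and Y: "smooth_on Y S"
  shows "smooth_on (\<lambda>p. G p (X p) (Y p)) S"
proof -
  have "smooth_on (\<lambda>p. G p (X p) w) S" for w
    by (rule smooth_on_linear_family[where L = "\<lambda>p v. G p v w", OF S _ G X])
      (use bil in \<open>auto simp: bilinear_def\<close>)
  then show ?thesis
    by (intro smooth_on_linear_family[where L = "\<lambda>p. G p (X p)", OF S _ _ Y])
      (use bil in \<open>auto simp: bilinear_def\<close>)
qed

text \<open>
  The system \<open>G p (X p) i = \<beta> i p\<close> is solved for \<open>i\<close> in a growing set of basis vectors, by the
  Gram--Schmidt process without normalization. Subtracting from a new basis vector \<open>j\<close> its
  projection to the span of the old ones gives a vector \<open>N\<close> orthogonal to these, and a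
  multiple of \<open>N\<close> corrects the old solution. Since only field operations occur, smoothness is
  preserved, and no determinant is needed.
\<close>

lemma smooth_solution_on_basis_subset:
  fixes G :: "'b::real_normed_vector \<Rightarrow> 'e::euclidean_space \<Rightarrow> 'e \<Rightarrow> real"
  assumes S: "open S" and bil: "\<And>p. p \<in> S \<Longrightarrow> bilinear (G p)"
    and sym: "\<And>p v w. p \<in> S \<Longrightarrow> G p v w = G p w v"
    and pos: "\<And>p v. p \<in> S \<Longrightarrow> v \<noteq> 0 \<Longrightarrow> G p v v > 0"
    and G: "\<And>v w. smooth_on (\<lambda>p. G p v w) S"
    and "finite B" "B \<subseteq> Basis" and "\<And>i. smooth_on (\<beta> i) S"
  shows "\<exists>X. smooth_on X S \<and> (\<forall>p\<in>S. X p \<in> span B \<and> (\<forall>i\<in>B. G p (X p) i = \<beta> i p))"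
  using assms(6-8)
proof (induction B arbitrary: \<beta> rule: finite_induct)
  case empty
  show ?case
    by (rule exI[of _ "\<lambda>_. 0"]) (simp add: smooth_on_const S)
next
  case (insert j B)
  note \<beta> = insert.prems(2)
  have B: "B \<subseteq> Basis" using insert.prems by simp
  note smooth_G = smooth_on_bilinear_family[OF S bil G]
  obtain Y where Y: "smooth_on Y S" "\<And>p. p \<in> S \<Longrightarrow> Y p \<in> span B"
      "\<And>p i. p \<in> S \<Longrightarrow> i \<in> B \<Longrightarrow> G p (Y p) i = G p j i"
    using insert.IH[OF B, of "\<lambda>i p. G p j i"] G by blast
  obtain X0 where X0: "smooth_on X0 S" "\<And>p. p \<in> S \<Longrightarrow> X0 p \<in> span B"
      "\<And>p i. p \<in> S \<Longrightarrow> i \<in> B \<Longrightarrow> G p (X0 p) i = \<beta> i p"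
    using insert.IH[OF B, of \<beta>] \<beta> by blast
  define N where "N p = j - Y p" for p
  have N_smooth: "smooth_on N S"
    unfolding N_def by (intro smooth_on_diff smooth_on_const S Y)
  have N_orth: "G p (N p) i = 0" if "p \<in> S" "i \<in> B" for p i
    using Y(3)[OF that] by (simp add: N_def bilinear_lsub[OF bil[OF that(1)]])
  have N_orth_span: "G p (N p) v = 0" if p: "p \<in> S" and v: "v \<in> span B" for p v
    using v
  proof (rule linear_eq_0_on_span[rotated 2])
    show "linear (G p (N p))"
      using bil[OF p] by (simp add: bilinear_def)
  qed (use N_orth p in auto)
  have "j \<notin> span B"
    using independent_Basis insert.prems(1) insert.hyps independent_mono
    by (metis independent_insert)
  then have "N p \<noteq> 0" if "p \<in> S" for p
    using Y(2)[OF that] by (auto simp: N_def)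
  then have N_pos: "G p (N p) (N p) > 0" if "p \<in> S" for p
    using pos that by blast
  have N_j: "G p (N p) j = G p (N p) (N p)" if "p \<in> S" for p
  proof -
    have "G p (N p) (j - Y p) = G p (N p) j - G p (N p) (Y p)"
      by (rule bilinear_rsub[OF bil[OF that]])
    then show ?thesis
      using N_orth_span[OF that Y(2)[OF that]] by (simp add: N_def)
  qed
  define X where
    "X p = X0 p + ((\<beta> j p - G p (X0 p) j) / G p (N p) (N p)) *\<^sub>R N p" for p
  have "smooth_on X S"
    unfolding X_def
    by (intro smooth_on_add smooth_on_scaleR smooth_on_divide smooth_on_diff smooth_G
        smooth_on_const S X0 N_smooth \<beta>) (use N_pos in \<open>auto simp: less_imp_neq[symmetric]\<close>)
  moreover have "X p \<in> span (insert j B)" if "p \<in> S" for p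
  proof -
    have "X0 p \<in> span (insert j B)" "Y p \<in> span (insert j B)"
      using X0(2)[OF that] Y(2)[OF that] span_mono[of B "insert j B"] by auto
    then show ?thesis
      by (simp add: X_def N_def span_add span_scale span_diff span_base)
  qed
  moreover have "G p (X p) i = \<beta> i p" if "p \<in> S" "i \<in> insert j B" for p i
    using that N_pos[OF that(1)] X0(3)[OF that(1)] N_orth[OF that(1)] N_j[OF that(1)]
    by (auto simp: X_def bilinear_ladd[OF bil] bilinear_lmul[OF bil])
  ultimately show ?case by blast
qed

lemma smooth_solution_positive_definite:
  fixes G :: "'b::real_normed_vector \<Rightarrow> 'e::euclidean_space \<Rightarrow> 'e \<Rightarrow> real"
  assumes S: "open S" and bil: "\<And>p. p \<in> S \<Longrightarrow> bilinear (G p)"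
    and "\<And>p v w. p \<in> S \<Longrightarrow> G p v w = G p w v"
    and "\<And>p v. p \<in> S \<Longrightarrow> v \<noteq> 0 \<Longrightarrow> G p v v > 0"
    and "\<And>v w. smooth_on (\<lambda>p. G p v w) S"
    and lin: "\<And>p. p \<in> S \<Longrightarrow> linear (L p)" and "\<And>w. smooth_on (\<lambda>p. L p w) S"
  shows "\<exists>X. smooth_on X S \<and> (\<forall>p\<in>S. \<forall>w. G p (X p) w = L p w)"
proof -
  obtain X where X: "smooth_on X S" "\<And>p i. p \<in> S \<Longrightarrow> i \<in> Basis \<Longrightarrow> G p (X p) i = L p i"
    using smooth_solution_on_basis_subset[OF assms(1-5) finite_Basis subset_refl,
        where \<beta> = "\<lambda>i p. L p i"] assms(7) by blast
  have "G p (X p) w = L p w" if p: "p \<in> S" for p w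
  proof -
    have "linear (G p (X p))"
      using bil[OF p] by (simp add: bilinear_def)
    from linear_eq_on_span[OF this lin[OF p], of Basis w] X(2)[OF p] show ?thesis
      by simp
  qed
  then show ?thesis using X(1) by blast
qed

section \<open>Inner products on a tangent space\<close>

locale tangent_inner =
  fixes M :: "'a topology" and A :: "('a, 'e::euclidean_space) chart set" and x :: 'a
    and g :: "('a, 'e) tvec \<Rightarrow> ('a, 'e) tvec \<Rightarrow> real"
  assumes manifold: "smooth_manifold M A"
    and sym: "u \<in> tangent_space A x \<Longrightarrow> v \<in> tangent_space A x \<Longrightarrow> g u v = g v u"
    and scale_left: "u \<in> tangent_space A x \<Longrightarrow> v \<in> tangent_space A x \<Longrightarrow>
      g (tscale r u) v = r * g u v"
    and add_left: "u \<in> tangent_space A x \<Longrightarrow> v \<in> tangent_space A x \<Longrightarrow>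
      w \<in> tangent_space A x \<Longrightarrow> g (tadd u w) v = g u v + g w v"
    and pos: "u \<in> tangent_space A x \<Longrightarrow> u \<noteq> tzero \<Longrightarrow> g u u > 0"
begin

lemmas add_closed = tangent_space_tadd[OF manifold]
lemmas scale_closed = tangent_space_tscale[OF manifold]
lemmas zero_closed = tzero_tangent_space[OF manifold]

lemma scale_right:
  "u \<in> tangent_space A x \<Longrightarrow> v \<in> tangent_space A x \<Longrightarrow> g u (tscale r v) = r * g u v"
  by (simp add: sym[of u] scale_left scale_closed)

lemma add_right:
  "u \<in> tangent_space A x \<Longrightarrow> v \<in> tangent_space A x \<Longrightarrow> w \<in> tangent_space A x \<Longrightarrow>
    g u (tadd v w) = g u v + g u w"
  by (simp add: sym[of u] add_left add_closed)

lemma zero_left: "v \<in> tangent_space A x \<Longrightarrow> g tzero v = 0"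
  using scale_left[OF zero_closed, of v 0] by (simp add: tscale_def tzero_def)

lemma nonneg: "u \<in> tangent_space A x \<Longrightarrow> g u u \<ge> 0"
  using pos[of u] zero_left[OF zero_closed] by (cases "u = tzero") auto

lemma eqI:
  assumes u: "u \<in> tangent_space A x" and v: "v \<in> tangent_space A x"
    and eq: "\<And>w. w \<in> tangent_space A x \<Longrightarrow> g u w = g v w"
  shows "u = v"
proof -
  define w where "w = tadd u (tscale (- 1) v)"
  have v': "tscale (- 1) v \<in> tangent_space A x" by (rule scale_closed[OF v])
  have w: "w \<in> tangent_space A x" unfolding w_def by (rule add_closed[OF u v'])
  have "g w w = 0"
    using add_left[OF u w v'] scale_left[OF v w, of "- 1"] eq[OF w] by (simp add: w_def)
  then have "w = tzero" using pos[OF w] by auto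
  then show ?thesis by (simp add: w_def tadd_def tscale_def tzero_def fun_eq_iff)
qed

end

lemma riemannian_metric_iff:
  assumes "smooth_manifold M A"
  shows "riemannian_metric M A h \<longleftrightarrow> (\<forall>x\<in>topspace M. tangent_inner M A x (h x)) \<and>
    (\<forall>c\<in>A. \<forall>w1 w2. smooth_on
        (\<lambda>p. h (chart_inv c p) (coord_vec A c (chart_inv c p) w1)
                               (coord_vec A c (chart_inv c p) w2)) (chart_image c))"
  unfolding riemannian_metric_def tangent_inner_def using assms by blast

section \<open>Coordinates on tangent spaces\<close>

lemma point_of_chart_image:
  assumes M: "smooth_manifold M A" and c: "c \<in> A" and p: "p \<in> chart_image c"
  shows "c \<in> charts_at A (chart_inv c p)" and "chart_inv c p \<in> topspace M"
proof -
  have "chart_inv c p \<in> fst c"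
    using p by (auto simp: chart_image_def chart_inv_def intro: inv_into_into)
  then show "c \<in> charts_at A (chart_inv c p)" "chart_inv c p \<in> topspace M"
    using M c by (auto simp: charts_at_def smooth_manifold_def)
qed

lemma chart_around:
  assumes M: "smooth_manifold M A" and x: "x \<in> topspace M"
  obtains c p where "c \<in> A" "p \<in> chart_image c" "chart_inv c p = x"
proof -
  have "x \<in> (\<Union>c\<in>A. fst c)"
    using M x by (simp add: smooth_manifold_def)
  then obtain c where c: "c \<in> A" "x \<in> fst c"
    by blast
  then have "chart_inv c (snd c x) = x" "snd c x \<in> chart_image c"
    using M by (auto simp: smooth_manifold_def chart_inv_chart chart_image_def)
  then show thesis using that c(1) by blast
qed

lemma open_chart_image: "smooth_manifold M A \<Longrightarrow> c \<in> A \<Longrightarrow> open (chart_image c)"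
  by (auto simp: smooth_manifold_def is_chart_def)

lemma coord_vec_tangent:
  "smooth_manifold M A \<Longrightarrow> c \<in> charts_at A x \<Longrightarrow> coord_vec A c x w \<in> tangent_space A x"
  using coord_vec_bij[of M A c x] by (auto simp: bij_betw_def)

lemma coord_vec_component:
  "smooth_manifold M A \<Longrightarrow> c \<in> charts_at A x \<Longrightarrow> coord_vec A c x w c = w"
  by (simp add: coord_vec_def transition_derivative_self)

lemma coord_vec_of_component:
  assumes "c \<in> charts_at A x" "v \<in> tangent_space A x"
  shows "coord_vec A c x (v c) = v"
  using assms by (auto simp: coord_vec_def tangent_space_transform tangent_space_off)

lemma coord_vec_add:
  assumes "smooth_manifold M A" "c \<in> charts_at A x"
  shows "coord_vec A c x (v + w) = tadd (coord_vec A c x v) (coord_vec A c x w)"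
  using assms by (auto simp: coord_vec_def tadd_def linear_add[OF transition_linear(2)])

lemma coord_vec_scale:
  assumes "smooth_manifold M A" "c \<in> charts_at A x"
  shows "coord_vec A c x (r *\<^sub>R v) = tscale r (coord_vec A c x v)"
  using assms by (auto simp: coord_vec_def tscale_def linear_cmul[OF transition_linear(2)])

lemma coord_vec_nonzero:
  assumes "smooth_manifold M A" "c \<in> charts_at A x" "w \<noteq> 0"
  shows "coord_vec A c x w \<noteq> tzero"
  using coord_vec_component[OF assms(1,2), of w] assms(3) by (auto simp: tzero_def)

lemma nonzero_tangent_vector:
  fixes A :: "('a, 'e::euclidean_space) chart set"
  assumes M: "smooth_manifold M A" and x: "x \<in> topspace M"
  obtains v where "v \<in> tangent_space A x" "v \<noteq> tzero"
proof -
  obtain c p where c: "c \<in> A" "p \<in> chart_image c" "chart_inv c p = x"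
    using chart_around[OF M x] by blast
  have cx: "c \<in> charts_at A x" using point_of_chart_image[OF M c(1,2)] c(3) by simp
  obtain e :: 'e where "e \<in> Basis" using nonempty_Basis by blast
  then show thesis
    using that coord_vec_tangent[OF M cx, of e] coord_vec_nonzero[OF M cx, of e] nonzero_Basis
    by blast
qed

lemma bilinear_metric_in_chart:
  assumes M: "smooth_manifold M A" and h: "riemannian_metric M A h"
    and c: "c \<in> A" and p: "p \<in> chart_image c"
  shows "bilinear (\<lambda>v w. h (chart_inv c p) (coord_vec A c (chart_inv c p) v)
                                            (coord_vec A c (chart_inv c p) w))"
proof -
  note q = point_of_chart_image[OF M c p]
  interpret tangent_inner M A "chart_inv c p" "h (chart_inv c p)"
    using h q(2) by (simp add: riemannian_metric_iff[OF M])
  note T = coord_vec_tangent[OF M q(1)]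
  show ?thesis
    unfolding bilinear_def
    by (intro conjI allI linearI)
      (simp_all add: coord_vec_add[OF M q(1)] coord_vec_scale[OF M q(1)]
        add_left[OF T T T] add_right[OF T T T] scale_left[OF T T] scale_right[OF T T])
qed

lemma linear_one_form_in_chart:
  assumes M: "smooth_manifold M A" and b: "smooth_one_form M A b"
    and c: "c \<in> A" and p: "p \<in> chart_image c"
  shows "linear (\<lambda>v. b (chart_inv c p) (coord_vec A c (chart_inv c p) v))"
proof -
  note q = point_of_chart_image[OF M c p]
  note T = coord_vec_tangent[OF M q(1)]
  have "b (chart_inv c p) (tadd u v) = b (chart_inv c p) u + b (chart_inv c p) v"
      "b (chart_inv c p) (tscale r u) = r * b (chart_inv c p) u"
    if "u \<in> tangent_space A (chart_inv c p)" "v \<in> tangent_space A (chart_inv c p)" for u v r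
    using b q(2) that by (auto simp: smooth_one_form_def)
  note lin = this[OF T T]
  show ?thesis
    by (intro linearI) (simp_all add: coord_vec_add[OF M q(1)] coord_vec_scale[OF M q(1)] lin)
qed

lemma smooth_on_metric_of_fields:
  assumes M: "smooth_manifold M A" and h: "riemannian_metric M A h" and c: "c \<in> A"
    and "smooth_on X (chart_image c)" "smooth_on Y (chart_image c)"
  shows "smooth_on (\<lambda>p. h (chart_inv c p) (coord_vec A c (chart_inv c p) (X p))
      (coord_vec A c (chart_inv c p) (Y p))) (chart_image c)"
proof (rule smooth_on_bilinear_family[OF open_chart_image[OF M c] bilinear_metric_in_chart[OF M h c]
      _ assms(4,5)])
  show "smooth_on (\<lambda>p. h (chart_inv c p) (coord_vec A c (chart_inv c p) v)
      (coord_vec A c (chart_inv c p) w)) (chart_image c)" for v w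
    using h c by (simp add: riemannian_metric_iff[OF M])
qed

lemma vector_field_in_chart:
  assumes "smooth_manifold M A" "smooth_vector_field M A W" "c \<in> A" "p \<in> chart_image c"
  shows "coord_vec A c (chart_inv c p) (W (chart_inv c p) c) = W (chart_inv c p)"
proof (rule coord_vec_of_component)
  note q = point_of_chart_image[OF assms(1,3,4)]
  show "c \<in> charts_at A (chart_inv c p)" by (rule q(1))
  show "W (chart_inv c p) \<in> tangent_space A (chart_inv c p)"
    using assms(2) q(2) by (simp add: smooth_vector_field_def)
qed

lemma smooth_on_metric_field_const:
  assumes M: "smooth_manifold M A" and h: "riemannian_metric M A h"
    and W: "smooth_vector_field M A W" and c: "c \<in> A"
  shows "smooth_on (\<lambda>p. h (chart_inv c p) (W (chart_inv c p))
      (coord_vec A c (chart_inv c p) w)) (chart_image c)"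
proof (rule smooth_on_cong[OF open_chart_image[OF M c]])
  show "smooth_on (\<lambda>p. h (chart_inv c p) (coord_vec A c (chart_inv c p) (W (chart_inv c p) c))
      (coord_vec A c (chart_inv c p) w)) (chart_image c)"
    using W c by (intro smooth_on_metric_of_fields[OF M h c] smooth_on_const open_chart_image[OF M c])
      (simp add: smooth_vector_field_def)
qed (simp only: vector_field_in_chart[OF M W c])

lemma smooth_fun_metric_of_field:
  assumes M: "smooth_manifold M A" and h: "riemannian_metric M A h"
    and W: "smooth_vector_field M A W"
  shows "smooth_fun A (\<lambda>x. h x (W x) (W x))"
  unfolding smooth_fun_def
proof
  fix c assume c: "c \<in> A"
  let ?W = "\<lambda>p. coord_vec A c (chart_inv c p) (W (chart_inv c p) c)"
  show "smooth_on (\<lambda>p. h (chart_inv c p) (W (chart_inv c p)) (W (chart_inv c p)))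
      (chart_image c)"
  proof (rule smooth_on_cong[OF open_chart_image[OF M c]])
    show "smooth_on (\<lambda>p. h (chart_inv c p) (?W p) (?W p)) (chart_image c)"
      using W c by (intro smooth_on_metric_of_fields[OF M h c]) (simp_all add: smooth_vector_field_def)
  qed (simp only: vector_field_in_chart[OF M W c])
qed

text \<open>
  The vector field dual to a 1-form \<open>b\<close> is found in each chart as the smooth solution of a
  positive definite linear system; at a point it does not depend on the chart, because the
  metric determines it.
\<close>

lemma smooth_dual_vector_field:
  assumes M: "smooth_manifold M A" and a: "riemannian_metric M A a"
    and b: "smooth_one_form M A b"
  obtains B where "smooth_vector_field M A B"
    and "\<And>x v. x \<in> topspace M \<Longrightarrow> v \<in> tangent_space A x \<Longrightarrow> a x (B x) v = b x v"
proof -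
  let ?dual = "\<lambda>x u. u \<in> tangent_space A x \<and> (\<forall>v\<in>tangent_space A x. a x u v = b x v)"
  have inner: "tangent_inner M A x (a x)" if "x \<in> topspace M" for x
    using a that by (simp add: riemannian_metric_iff[OF M])
  have dual_unique: "u = v" if "x \<in> topspace M" "?dual x u" "?dual x v" for x u v
    by (rule tangent_inner.eqI[OF inner[OF that(1)]]) (simp_all add: that(2,3))
  have loc: "\<exists>X. smooth_on X (chart_image c) \<and>
      (\<forall>p\<in>chart_image c. ?dual (chart_inv c p) (coord_vec A c (chart_inv c p) (X p)))"
    if c: "c \<in> A" for c
  proof -
    let ?cv = "\<lambda>p. coord_vec A c (chart_inv c p)"
    note q = point_of_chart_image[OF M c]
    have "\<exists>X. smooth_on X (chart_image c) \<and>
        (\<forall>p\<in>chart_image c. \<forall>w. a (chart_inv c p) (?cv p (X p)) (?cv p w) = b (chart_inv c p) (?cv p w))"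
    proof (rule smooth_solution_positive_definite[OF open_chart_image[OF M c]
          bilinear_metric_in_chart[OF M a c]])
      fix p v w assume p: "p \<in> chart_image c"
      note T = coord_vec_tangent[OF M q(1)[OF p]]
      show "a (chart_inv c p) (?cv p v) (?cv p w) = a (chart_inv c p) (?cv p w) (?cv p v)"
        by (rule tangent_inner.sym[OF inner[OF q(2)[OF p]] T T])
      show "a (chart_inv c p) (?cv p v) (?cv p v) > 0" if "v \<noteq> 0"
        by (rule tangent_inner.pos[OF inner[OF q(2)[OF p]] T coord_vec_nonzero[OF M q(1)[OF p] that]])
    next
      show "smooth_on (\<lambda>p. a (chart_inv c p) (?cv p v) (?cv p w)) (chart_image c)" for v w
        using a c by (simp add: riemannian_metric_iff[OF M])
      show "smooth_on (\<lambda>p. b (chart_inv c p) (?cv p w)) (chart_image c)" for w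
        using b c by (simp add: smooth_one_form_def)
    qed (simp_all add: linear_one_form_in_chart[OF M b c])
    then obtain X where X: "smooth_on X (chart_image c)" "\<And>p w. p \<in> chart_image c \<Longrightarrow>
        a (chart_inv c p) (?cv p (X p)) (?cv p w) = b (chart_inv c p) (?cv p w)"
      by blast
    have "?dual (chart_inv c p) (?cv p (X p))" if p: "p \<in> chart_image c" for p
    proof (intro conjI ballI)
      fix v assume v: "v \<in> tangent_space A (chart_inv c p)"
      show "a (chart_inv c p) (?cv p (X p)) v = b (chart_inv c p) v"
        using X(2)[OF p, of "v c"] by (simp only: coord_vec_of_component[OF q(1)[OF p] v])
    qed (rule coord_vec_tangent[OF M q(1)[OF p]])
    then show ?thesis using X(1) by blast
  qed
  define B where "B x = (SOME u. ?dual x u)" for x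
  have B: "?dual x (B x)" if x: "x \<in> topspace M" for x
  proof -
    obtain c p where c: "c \<in> A" "p \<in> chart_image c" "chart_inv c p = x"
      using chart_around[OF M x] by blast
    obtain X where "\<forall>p\<in>chart_image c. ?dual (chart_inv c p) (coord_vec A c (chart_inv c p) (X p))"
      using loc[OF c(1)] by blast
    then have "?dual x (coord_vec A c x (X p))"
      unfolding c(3)[symmetric] using c(2) by (rule bspec)
    then show ?thesis
      unfolding B_def by (rule someI[where P = "?dual x"])
  qed
  have "smooth_on (\<lambda>p. B (chart_inv c p) c) (chart_image c)" if c: "c \<in> A" for c
  proof -
    obtain X where X: "smooth_on X (chart_image c)"
      "\<And>p. p \<in> chart_image c \<Longrightarrow> ?dual (chart_inv c p) (coord_vec A c (chart_inv c p) (X p))"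
      using loc[OF c] by blast
    show ?thesis
    proof (rule smooth_on_cong[OF open_chart_image[OF M c] _ X(1)])
      fix p assume p: "p \<in> chart_image c"
      note q = point_of_chart_image[OF M c p]
      have "coord_vec A c (chart_inv c p) (X p) = B (chart_inv c p)"
        by (rule dual_unique[OF q(2) X(2)[OF p] B[OF q(2)]])
      then show "X p = B (chart_inv c p) c"
        using coord_vec_component[OF M q(1), of "X p"] by simp
    qed
  qed
  then have "smooth_vector_field M A B"
    using B by (simp add: smooth_vector_field_def)
  then show thesis using that[of B] B by blast
qed

section \<open>Arithmetic of smooth tensor fields\<close>

lemma smooth_fun_const: "smooth_manifold M A \<Longrightarrow> smooth_fun A (\<lambda>x. k)"
  by (simp add: smooth_fun_def smooth_on_const open_chart_image)

lemma smooth_fun_mult: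
  "smooth_manifold M A \<Longrightarrow> smooth_fun A r \<Longrightarrow> smooth_fun A s \<Longrightarrow> smooth_fun A (\<lambda>x. r x * s x)"
  by (simp add: smooth_fun_def smooth_on_mult open_chart_image)

lemma smooth_fun_diff:
  "smooth_manifold M A \<Longrightarrow> smooth_fun A r \<Longrightarrow> smooth_fun A s \<Longrightarrow> smooth_fun A (\<lambda>x. r x - s x)"
  by (simp add: smooth_fun_def smooth_on_diff open_chart_image)

lemma smooth_fun_divide:
  assumes M: "smooth_manifold M A" and "smooth_fun A r" "smooth_fun A s"
    and nz: "\<And>x. x \<in> topspace M \<Longrightarrow> s x \<noteq> 0"
  shows "smooth_fun A (\<lambda>x. r x / s x)"
  using assms(2,3) by (simp add: smooth_fun_def smooth_on_divide open_chart_image[OF M]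
      nz point_of_chart_image(2)[OF M])

lemma smooth_vector_field_scale:
  assumes M: "smooth_manifold M A" and r: "smooth_fun A r" and W: "smooth_vector_field M A W"
  shows "smooth_vector_field M A (\<lambda>x. tscale (r x) (W x))"
  unfolding smooth_vector_field_def
proof (intro conjI ballI)
  show "tscale (r x) (W x) \<in> tangent_space A x" if "x \<in> topspace M" for x
    using that W by (simp add: smooth_vector_field_def tangent_space_tscale[OF M])
  show "smooth_on (\<lambda>p. tscale (r (chart_inv c p)) (W (chart_inv c p)) c) (chart_image c)"
    if c: "c \<in> A" for c
    unfolding tscale_def using r W c
    by (intro smooth_on_scaleR open_chart_image[OF M c])
      (simp_all add: smooth_fun_def smooth_vector_field_def)
qed

lemma smooth_one_form_scale:
  assumes M: "smooth_manifold M A" and r: "smooth_fun A r" and b: "smooth_one_form M A b"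
  shows "smooth_one_form M A (\<lambda>x v. r x * b x v)"
  unfolding smooth_one_form_def
proof (intro conjI ballI allI)
  fix x u v k assume "x \<in> topspace M" "u \<in> tangent_space A x" "v \<in> tangent_space A x"
  then have "b x (tadd u v) = b x u + b x v" "b x (tscale k u) = k * b x u"
    using b by (auto simp: smooth_one_form_def)
  then show "r x * b x (tadd u v) = r x * b x u + r x * b x v"
    "r x * b x (tscale k u) = k * (r x * b x u)"
    by (simp_all add: algebra_simps)
next
  fix c w assume c: "c \<in> A"
  show "smooth_on (\<lambda>p. r (chart_inv c p) * b (chart_inv c p) (coord_vec A c (chart_inv c p) w))
      (chart_image c)"
    using r b c by (intro smooth_on_mult open_chart_image[OF M c])
      (simp_all add: smooth_fun_def smooth_one_form_def)
qed

lemma smooth_one_form_metric_field: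
  assumes M: "smooth_manifold M A" and h: "riemannian_metric M A h"
    and W: "smooth_vector_field M A W"
  shows "smooth_one_form M A (\<lambda>x. h x (W x))"
  unfolding smooth_one_form_def
proof (intro conjI ballI allI)
  fix x u v r assume x: "x \<in> topspace M" and u: "u \<in> tangent_space A x" and v: "v \<in> tangent_space A x"
  interpret tangent_inner M A x "h x"
    using h x by (simp add: riemannian_metric_iff[OF M])
  have Wx: "W x \<in> tangent_space A x" using W x by (simp add: smooth_vector_field_def)
  show "h x (W x) (tadd u v) = h x (W x) u + h x (W x) v" by (rule add_right[OF Wx u v])
  show "h x (W x) (tscale r u) = r * h x (W x) u" by (rule scale_right[OF Wx u])
qed (rule smooth_on_metric_field_const[OF M h W])

text \<open>Both passages between Randers data and navigation data, and conformal changes, replace a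
  metric by one of this form.\<close>

lemma riemannian_metric_rank_one_update:
  assumes M: "smooth_manifold M A" and a: "riemannian_metric M A a"
    and b: "smooth_one_form M A b" and r: "smooth_fun A r" and s: "smooth_fun A s"
    and definite: "\<And>x u. x \<in> topspace M \<Longrightarrow> u \<in> tangent_space A x \<Longrightarrow> u \<noteq> tzero \<Longrightarrow>
      r x * a x u u + s x * (b x u)\<^sup>2 > 0"
  shows "riemannian_metric M A (\<lambda>x u v. r x * a x u v + s x * (b x u * b x v))"
  unfolding riemannian_metric_iff[OF M]
proof (intro conjI ballI allI)
  fix x assume x: "x \<in> topspace M"
  interpret tangent_inner M A x "a x"
    using a x by (simp add: riemannian_metric_iff[OF M])
  have b_add: "b x (tadd u v) = b x u + b x v" and b_scale: "b x (tscale k u) = k * b x u"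
    if "u \<in> tangent_space A x" "v \<in> tangent_space A x" for u v k
    using b x that by (auto simp: smooth_one_form_def)
  show "tangent_inner M A x (\<lambda>u v. r x * a x u v + s x * (b x u * b x v))"
  proof
    fix u v w k
    assume u: "u \<in> tangent_space A x"
    show "r x * a x u u + s x * (b x u * b x u) > 0" if "u \<noteq> tzero"
      using definite[OF x u that] by (simp add: power2_eq_square)
    assume v: "v \<in> tangent_space A x"
    show "r x * a x u v + s x * (b x u * b x v) = r x * a x v u + s x * (b x v * b x u)"
      using sym[OF u v] by simp
    show "r x * a x (tscale k u) v + s x * (b x (tscale k u) * b x v)
        = k * (r x * a x u v + s x * (b x u * b x v))"
      by (simp add: scale_left[OF u v] b_scale[OF u v] algebra_simps)
    assume w: "w \<in> tangent_space A x"
    show "r x * a x (tadd u w) v + s x * (b x (tadd u w) * b x v)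
        = r x * a x u v + s x * (b x u * b x v) + (r x * a x w v + s x * (b x w * b x v))"
      by (simp add: add_left[OF u v w] b_add[OF u w] algebra_simps)
  qed (rule M)
next
  fix c v w assume c: "c \<in> A"
  show "smooth_on (\<lambda>p. r (chart_inv c p) *
        a (chart_inv c p) (coord_vec A c (chart_inv c p) v) (coord_vec A c (chart_inv c p) w) +
        s (chart_inv c p) * (b (chart_inv c p) (coord_vec A c (chart_inv c p) v) *
          b (chart_inv c p) (coord_vec A c (chart_inv c p) w))) (chart_image c)"
    using a b r s c by (intro smooth_on_add smooth_on_mult open_chart_image[OF M c])
      (simp_all add: smooth_fun_def smooth_one_form_def riemannian_metric_iff[OF M])
qed

section \<open>Zermelo navigation\<close>

text \<open>The denominator of the explicit formula.\<close>

definition speed_gap ::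
    "('a \<Rightarrow> ('a, 'e::euclidean_space) tvec \<Rightarrow> ('a, 'e) tvec \<Rightarrow> real) \<Rightarrow>
     ('a \<Rightarrow> ('a, 'e) tvec) \<Rightarrow> ('a \<Rightarrow> real) \<Rightarrow> 'a \<Rightarrow> real" where
  "speed_gap h W f x = (f x)\<^sup>2 - h x (W x) (W x)"

lemma zermelo_data_at_point:
  assumes M: "smooth_manifold M A" and Z: "zermelo_data M A h W f" and x: "x \<in> topspace M"
  shows "tangent_inner M A x (h x)" "W x \<in> tangent_space A x" "f x > 0" "speed_gap h W f x > 0"
proof -
  show inner: "tangent_inner M A x (h x)" and W: "W x \<in> tangent_space A x" and f: "f x > 0"
    using Z x by (auto simp: zermelo_data_def riemannian_metric_iff[OF M] smooth_vector_field_def)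
  have "metric_norm h x (W x) < f x"
    using Z x by (simp add: zermelo_data_def)
  from power_strict_mono[OF this, of 2] show "speed_gap h W f x > 0"
    using tangent_inner.nonneg[OF inner W] by (simp add: metric_norm_def speed_gap_def)
qed

lemma zermelo_formula_speed_gap:
  assumes M: "smooth_manifold M A" and Z: "zermelo_data M A h W f"
    and x: "x \<in> topspace M" and y: "y \<in> tangent_space A x"
  shows "zermelo_formula h W f x y =
    (sqrt ((h x (W x) y)\<^sup>2 + h x y y * speed_gap h W f x) - h x (W x) y) / speed_gap h W f x"
  using tangent_inner.nonneg[OF zermelo_data_at_point(1)[OF M Z x]]
    zermelo_data_at_point(2)[OF M Z x] y
  by (simp add: zermelo_formula_def metric_norm_def speed_gap_def)

lemma smooth_fun_speed_gap:
  assumes M: "smooth_manifold M A" and Z: "zermelo_data M A h W f"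
  shows "smooth_fun A (speed_gap h W f)"
proof -
  have "smooth_fun A (\<lambda>x. h x (W x) (W x))"
    using Z by (intro smooth_fun_metric_of_field[OF M]) (auto simp: zermelo_data_def)
  moreover have "smooth_fun A (\<lambda>x. f x * f x)"
    using Z by (intro smooth_fun_mult[OF M]) (auto simp: zermelo_data_def)
  ultimately show ?thesis
    unfolding speed_gap_def power2_eq_square by (rule smooth_fun_diff[OF M, rotated])
qed

text \<open>
  Moving the denominator \<open>\<lambda> = f\<^sup>2 - h(W, W)\<close> of the explicit formula under the root
  displays the Randers data: \<open>a = h / \<lambda> + \<beta> \<otimes> \<beta> / \<lambda>\<^sup>2\<close> and \<open>b = - \<beta> / \<lambda>\<close>, where
  \<open>\<beta> = h(W, \<cdot>)\<close>.
\<close>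

lemma zermelo_solution_is_randers:
  assumes M: "smooth_manifold M A" and Z: "zermelo_data M A h W f"
    and F: "zermelo_solution M A h W f F"
  shows "is_randers M A F"
proof -
  define l where "l = speed_gap h W f"
  define \<beta> where "\<beta> x v = h x (W x) v" for x v
  have h: "riemannian_metric M A h" and W: "smooth_vector_field M A W"
    using Z by (auto simp: zermelo_data_def)
  have l_pos: "l x > 0" if "x \<in> topspace M" for x
    unfolding l_def by (rule zermelo_data_at_point(4)[OF M Z that])
  have l: "smooth_fun A l" unfolding l_def by (rule smooth_fun_speed_gap[OF M Z])
  have \<beta>: "smooth_one_form M A \<beta>"
    unfolding \<beta>_def by (rule smooth_one_form_metric_field[OF M h W])
  have quot: "smooth_fun A (\<lambda>x. k / l x)" "smooth_fun A (\<lambda>x. k / (l x * l x))" for k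
    by (intro smooth_fun_divide[OF M] smooth_fun_mult[OF M] smooth_fun_const[OF M] l;
        auto dest: l_pos)+
  have "riemannian_metric M A (\<lambda>x u v. 1 / l x * h x u v + 1 / (l x * l x) * (\<beta> x u * \<beta> x v))"
  proof (rule riemannian_metric_rank_one_update[OF M h \<beta> quot])
    fix x u assume x: "x \<in> topspace M" and u: "u \<in> tangent_space A x" "u \<noteq> tzero"
    have "0 < 1 / l x * h x u u"
      using l_pos[OF x] tangent_inner.pos[OF zermelo_data_at_point(1)[OF M Z x] u] by simp
    moreover have "0 \<le> 1 / (l x * l x) * (\<beta> x u)\<^sup>2"
      using l_pos[OF x] by simp
    ultimately show "0 < 1 / l x * h x u u + 1 / (l x * l x) * (\<beta> x u)\<^sup>2"
      by (rule add_pos_nonneg)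
  qed
  moreover have "smooth_one_form M A (\<lambda>x v. (- 1) / l x * \<beta> x v)"
    by (rule smooth_one_form_scale[OF M quot(1) \<beta>])
  moreover have "F x y = sqrt (1 / l x * h x y y + 1 / (l x * l x) * (\<beta> x y * \<beta> x y)) + (- 1) / l x * \<beta> x y"
    if x: "x \<in> topspace M" and y: "y \<in> tangent_space A x" for x y
  proof -
    have "1 / l x * h x y y + 1 / (l x * l x) * (\<beta> x y * \<beta> x y) = ((\<beta> x y)\<^sup>2 + h x y y * l x) / (l x)\<^sup>2"
      using l_pos[OF x] by (simp add: field_simps power2_eq_square)
    then have "sqrt (1 / l x * h x y y + 1 / (l x * l x) * (\<beta> x y * \<beta> x y))
        = sqrt ((\<beta> x y)\<^sup>2 + h x y y * l x) / l x"
      using l_pos[OF x] by (simp add: real_sqrt_divide)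
    moreover have "F x y = (sqrt ((\<beta> x y)\<^sup>2 + h x y y * l x) - \<beta> x y) / l x"
      using F x y zermelo_formula_speed_gap[OF M Z x y]
      by (simp add: zermelo_solution_iff_explicit[OF M Z] l_def \<beta>_def)
    ultimately show ?thesis
      by (simp add: diff_divide_distrib)
  qed
  ultimately show ?thesis
    unfolding is_randers_def by blast
qed

text \<open>
  Let \<open>F = \<surd>a + b\<close>, let \<open>B\<close> be the \<open>a\<close>-dual of \<open>b\<close>, and \<open>\<lambda> = 1 - a(B, B)\<close>. Then
  \<open>h = \<lambda> (a - b \<otimes> b)\<close>, \<open>W = - B / \<lambda>\<close> and \<open>f = 1\<close> invert the passage from navigation data to
  Randers data: \<open>h(W, \<cdot>) = - \<lambda> b\<close> and \<open>f\<^sup>2 - h(W, W) = \<lambda>\<close>. Both \<open>\<lambda> > 0\<close> and the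
  definiteness of \<open>h\<close> come from \<open>b\<^sup>2 < a\<close>, which holds because \<open>F\<close> is positive at \<open>y\<close> and at \<open>-y\<close>.
\<close>

lemma positive_randers_is_zermelo_solution:
  assumes M: "smooth_manifold M A" and R: "is_randers M A F"
    and F_pos: "\<And>x y. x \<in> topspace M \<Longrightarrow> y \<in> tangent_space A x \<Longrightarrow> y \<noteq> tzero \<Longrightarrow> F x y > 0"
  shows "\<exists>h W f. zermelo_data M A h W f \<and> zermelo_solution M A h W f F"
proof -
  obtain a b where a: "riemannian_metric M A a" and b: "smooth_one_form M A b"
    and F: "\<And>x y. x \<in> topspace M \<Longrightarrow> y \<in> tangent_space A x \<Longrightarrow> F x y = sqrt (a x y y) + b x y"
    using R unfolding is_randers_def by blast
  obtain B where B: "smooth_vector_field M A B"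
    and dual: "\<And>x v. x \<in> topspace M \<Longrightarrow> v \<in> tangent_space A x \<Longrightarrow> a x (B x) v = b x v"
    using smooth_dual_vector_field[OF M a b] by blast
  have inner: "tangent_inner M A x (a x)" and Bx: "B x \<in> tangent_space A x"
    if "x \<in> topspace M" for x
    using a B that by (simp_all add: riemannian_metric_iff[OF M] smooth_vector_field_def)
  have b_lt: "(b x y)\<^sup>2 < a x y y"
    if x: "x \<in> topspace M" and y: "y \<in> tangent_space A x" "y \<noteq> tzero" for x y
  proof -
    interpret tangent_inner M A x "a x" by (rule inner[OF x])
    let ?y = "tscale (- 1) y"
    have y': "?y \<in> tangent_space A x" by (rule scale_closed[OF y(1)])
    have "?y \<noteq> tzero" using y(2) by (auto simp: tscale_def tzero_def fun_eq_iff)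
    then have "F x ?y > 0" by (rule F_pos[OF x y'])
    moreover have "b x ?y = - b x y"
      using dual[OF x y'] dual[OF x y(1)] scale_right[OF Bx[OF x] y(1), of "- 1"] by simp
    moreover have "a x ?y ?y = a x y y"
      using scale_right[OF y' y(1), of "- 1"] scale_left[OF y(1) y(1), of "- 1"] by simp
    ultimately have "b x y < sqrt (a x y y)"
      using F[OF x y'] by simp
    moreover have "- b x y < sqrt (a x y y)"
      using F[OF x y(1)] F_pos[OF x y] by simp
    ultimately have "\<bar>b x y\<bar> < sqrt (a x y y)" by simp
    from power_strict_mono[OF this, of 2] show ?thesis
      using nonneg[OF y(1)] by simp
  qed
  define l where "l x = 1 - a x (B x) (B x)" for x
  have l_pos: "l x > 0" if x: "x \<in> topspace M" for x
  proof (cases "B x = tzero")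
    case True
    then show ?thesis
      using tangent_inner.zero_left[OF inner[OF x] Bx[OF x]] by (simp add: l_def)
  next
    case False
    \<comment> \<open>At \<open>y = B\<close> the bound \<open>b(y)\<^sup>2 < a(y, y)\<close> reads \<open>a(B, B)\<^sup>2 < a(B, B)\<close>.\<close>
    have "(a x (B x) (B x))\<^sup>2 < a x (B x) (B x)"
      using b_lt[OF x Bx[OF x] False] dual[OF x Bx[OF x]] by simp
    moreover have "a x (B x) (B x) > 0"
      by (rule tangent_inner.pos[OF inner[OF x] Bx[OF x] False])
    ultimately show ?thesis
      by (simp add: l_def power2_eq_square)
  qed
  have l: "smooth_fun A l"
    unfolding l_def
    by (intro smooth_fun_diff[OF M] smooth_fun_const[OF M] smooth_fun_metric_of_field[OF M a B])
  define h where "h x u v = l x * a x u v + (- 1) * l x * (b x u * b x v)" for x u v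
  define W where "W x = tscale ((- 1) / l x) (B x)" for x
  define f where "f x = (1::real)" for x :: 'a
  have h: "riemannian_metric M A h"
    unfolding h_def
  proof (rule riemannian_metric_rank_one_update[OF M a b l
        smooth_fun_mult[OF M smooth_fun_const[OF M] l]])
    fix x u assume x: "x \<in> topspace M" and u: "u \<in> tangent_space A x" "u \<noteq> tzero"
    have "0 < l x * (a x u u - (b x u)\<^sup>2)"
      using l_pos[OF x] b_lt[OF x u] by simp
    then show "0 < l x * a x u u + (- 1) * l x * (b x u)\<^sup>2"
      by (simp add: algebra_simps)
  qed
  have W: "smooth_vector_field M A W"
    unfolding W_def
    by (intro smooth_vector_field_scale[OF M _ B] smooth_fun_divide[OF M smooth_fun_const[OF M] l])
      (auto dest: l_pos)
  have Wx: "W x \<in> tangent_space A x" if "x \<in> topspace M" for x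
    using W that by (simp add: smooth_vector_field_def)
  have bW: "b x (W x) = (- 1) / l x * (1 - l x)" if x: "x \<in> topspace M" for x
  proof -
    interpret tangent_inner M A x "a x" by (rule inner[OF x])
    have "b x (W x) = a x (B x) (W x)" using dual[OF x Wx[OF x]] by simp
    also have "\<dots> = (- 1) / l x * a x (B x) (B x)"
      unfolding W_def by (rule scale_right[OF Bx[OF x] Bx[OF x]])
    finally show ?thesis by (simp add: l_def)
  qed
  have hW: "h x (W x) v = - (l x * b x v)"
    if x: "x \<in> topspace M" and v: "v \<in> tangent_space A x" for x v
  proof -
    interpret tangent_inner M A x "a x" by (rule inner[OF x])
    have aW: "a x (W x) v = (- 1) / l x * b x v"
      unfolding W_def scale_left[OF Bx[OF x] v] dual[OF x v] ..
    show ?thesis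
      unfolding h_def aW bW[OF x] using l_pos[OF x] by (simp add: field_simps)
  qed
  have hWW: "h x (W x) (W x) = 1 - l x" if x: "x \<in> topspace M" for x
    unfolding hW[OF x Wx[OF x]] bW[OF x] using l_pos[OF x] by simp
  have Z: "zermelo_data M A h W f"
    unfolding zermelo_data_def
  proof (intro conjI ballI)
    show "smooth_fun A f" unfolding f_def by (rule smooth_fun_const[OF M])
    show "metric_norm h x (W x) < f x" if "x \<in> topspace M" for x
      using hWW[OF that] l_pos[OF that] by (simp add: metric_norm_def f_def)
  qed (use h W in \<open>simp_all add: f_def\<close>)
  have "F x y = zermelo_formula h W f x y"
    if x: "x \<in> topspace M" and y: "y \<in> tangent_space A x" for x y
  proof -
    have gap: "speed_gap h W f x = l x"
      by (simp add: speed_gap_def f_def hWW[OF x])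
    have "(h x (W x) y)\<^sup>2 + h x y y * l x = (l x)\<^sup>2 * a x y y"
      unfolding hW[OF x y] by (simp add: h_def power2_eq_square algebra_simps)
    then show ?thesis
      unfolding F[OF x y] zermelo_formula_speed_gap[OF M Z x y] gap
      using l_pos[OF x] by (simp add: hW[OF x y] real_sqrt_mult add_divide_distrib)
  qed
  then have "zermelo_solution M A h W f F"
    by (simp add: zermelo_solution_iff_explicit[OF M Z])
  with Z show ?thesis by blast
qed

lemma zermelo_solution_no_wind:
  assumes M: "smooth_manifold M A" and Z: "zermelo_data M A h W f"
    and F: "zermelo_solution M A h W f F"
    and x: "x \<in> topspace M" and W: "W x = tzero" and y: "y \<in> tangent_space A x"
  shows "F x y = 1 / f x * metric_norm h x y"
proof -
  interpret tangent_inner M A x "h x" by (rule zermelo_data_at_point(1)[OF M Z x])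
  have "speed_gap h W f x = (f x)\<^sup>2"
    by (simp add: speed_gap_def W zero_left[OF zero_closed])
  moreover have "F x y = zermelo_formula h W f x y"
    using F x y by (simp add: zermelo_solution_iff_explicit[OF M Z])
  ultimately show ?thesis
    using zermelo_data_at_point(3)[OF M Z x]
    by (simp add: zermelo_formula_speed_gap[OF M Z x y] W zero_left[OF y] real_sqrt_mult
        metric_norm_def power2_eq_square)
qed

text \<open>
  The difference \<open>F(-y) - F(y) = 2 h(W, y) / (f\<^sup>2 - h(W, W))\<close> detects the wind. Reversibility
  in the single direction \<open>y = W\<close> is already enough.
\<close>

lemma reversible_zermelo_solution_no_wind:
  assumes M: "smooth_manifold M A" and Z: "zermelo_data M A h W f"
    and F: "zermelo_solution M A h W f F"
    and x: "x \<in> topspace M" and rev: "F x (tscale (- 1) (W x)) = F x (W x)"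
  shows "W x = tzero"
proof (rule ccontr)
  assume nz: "W x \<noteq> tzero"
  interpret tangent_inner M A x "h x" by (rule zermelo_data_at_point(1)[OF M Z x])
  note W = zermelo_data_at_point(2)[OF M Z x] and gap = zermelo_data_at_point(4)[OF M Z x]
  let ?V = "tscale (- 1) (W x)"
  have V: "?V \<in> tangent_space A x" by (rule scale_closed[OF W])
  have 1: "h x (W x) ?V = - h x (W x) (W x)" using scale_right[OF W W, of "- 1"] by simp
  have 2: "h x ?V ?V = h x (W x) (W x)"
    using scale_left[OF W V, of "- 1"] 1 by simp
  have "zermelo_formula h W f x ?V = zermelo_formula h W f x (W x)"
    using F x rev W V by (simp add: zermelo_solution_iff_explicit[OF M Z])
  then show False
    using gap pos[OF W nz]
    by (simp add: zermelo_formula_speed_gap[OF M Z x V] zermelo_formula_speed_gap[OF M Z x W] 1 2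
        divide_cancel_right)
qed

lemma metric_norm_scale:
  assumes M: "smooth_manifold M A" and h: "riemannian_metric M A h"
    and x: "x \<in> topspace M" and y: "y \<in> tangent_space A x"
  shows "metric_norm h x (tscale r y) = \<bar>r\<bar> * metric_norm h x y"
proof -
  interpret tangent_inner M A x "h x" using h x by (simp add: riemannian_metric_iff[OF M])
  have "h x (tscale r y) (tscale r y) = r\<^sup>2 * h x y y"
    using scale_left[OF y scale_closed[OF y]] scale_right[OF y y] by (simp add: power2_eq_square)
  then show ?thesis by (simp add: metric_norm_def real_sqrt_mult)
qed

lemma zermelo_solution_riemannian_iff_no_wind:
  assumes M: "smooth_manifold M A" and Z: "zermelo_data M A h W f"
    and F: "zermelo_solution M A h W f F"
  shows "is_riemannian M A F \<longleftrightarrow> (\<forall>x\<in>topspace M. W x = tzero)"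
proof
  assume "is_riemannian M A F"
  then obtain a where a: "riemannian_metric M A a"
    and Fa: "\<And>x y. x \<in> topspace M \<Longrightarrow> y \<in> tangent_space A x \<Longrightarrow> F x y = metric_norm a x y"
    by (auto simp: is_riemannian_def metric_norm_def)
  show "\<forall>x\<in>topspace M. W x = tzero"
  proof
    fix x assume x: "x \<in> topspace M"
    note W = zermelo_data_at_point(2)[OF M Z x]
    show "W x = tzero"
      by (rule reversible_zermelo_solution_no_wind[OF M Z F x])
        (simp add: Fa[OF x] tangent_space_tscale[OF M W] W metric_norm_scale[OF M a x W])
  qed
next
  assume W: "\<forall>x\<in>topspace M. W x = tzero"
  have h: "riemannian_metric M A h" and f: "smooth_fun A f"
    using Z by (auto simp: zermelo_data_def)
  have f_pos: "f x > 0" if "x \<in> topspace M" for x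
    by (rule zermelo_data_at_point(3)[OF M Z that])
  \<comment> \<open>The conformal metric \<open>h / f\<^sup>2\<close> is a rank-one update with vanishing second coefficient; any
    1-form serves there.\<close>
  have "riemannian_metric M A (\<lambda>x u v. 1 / (f x * f x) * h x u v + 0 * (h x (W x) u * h x (W x) v))"
  proof (rule riemannian_metric_rank_one_update[OF M h smooth_one_form_metric_field[OF M h]])
    show "smooth_vector_field M A W" using Z by (simp add: zermelo_data_def)
    show "smooth_fun A (\<lambda>x. 1 / (f x * f x))"
      by (intro smooth_fun_divide[OF M] smooth_fun_const[OF M] smooth_fun_mult[OF M] f)
        (auto dest: f_pos)
    show "smooth_fun A (\<lambda>x. 0)" by (rule smooth_fun_const[OF M])
    show "0 < 1 / (f x * f x) * h x u u + 0 * (h x (W x) u)\<^sup>2"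
      if "x \<in> topspace M" "u \<in> tangent_space A x" "u \<noteq> tzero" for x u
      using f_pos[OF that(1)] tangent_inner.pos[OF zermelo_data_at_point(1)[OF M Z that(1)] that(2,3)]
      by simp
  qed
  moreover have "F x y = sqrt (1 / (f x * f x) * h x y y + 0 * (h x (W x) y * h x (W x) y))"
    if "x \<in> topspace M" "y \<in> tangent_space A x" for x y
    using zermelo_solution_no_wind[OF M Z F that(1) _ that(2)] W that(1) f_pos[OF that(1)]
    by (simp add: metric_norm_def real_sqrt_divide real_sqrt_mult)
  ultimately show "is_riemannian M A F"
    unfolding is_riemannian_def by blast
qed

text \<open>The dimension being positive, there are vectors of every length.\<close>

lemma tangent_vector_of_length:
  assumes M: "smooth_manifold M A" and h: "riemannian_metric M A h"
    and x: "x \<in> topspace M" and r: "r > 0"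
  obtains u where "u \<in> tangent_space A x" "metric_norm h x u = r"
proof -
  interpret tangent_inner M A x "h x" using h x by (simp add: riemannian_metric_iff[OF M])
  obtain v where v: "v \<in> tangent_space A x" "v \<noteq> tzero"
    using nonzero_tangent_vector[OF M x] by blast
  then have n: "metric_norm h x v > 0" using pos by (simp add: metric_norm_def)
  have "metric_norm h x (tscale (r / metric_norm h x v) v) = r"
    using n r by (simp add: metric_norm_scale[OF M h x v(1)])
  then show thesis using that scale_closed[OF v(1)] by blast
qed

lemma zermelo_solution_homothetic_iff:
  assumes M: "smooth_manifold M A" and Z: "zermelo_data M A h W f"
    and F: "zermelo_solution M A h W f F"
  shows "(\<exists>c>0. \<forall>x\<in>topspace M. \<forall>y\<in>tangent_space A x. F x y = c * metric_norm h x y)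
    \<longleftrightarrow> (\<forall>x\<in>topspace M. W x = tzero) \<and> f constant_on topspace M"
proof
  assume "\<exists>c>0. \<forall>x\<in>topspace M. \<forall>y\<in>tangent_space A x. F x y = c * metric_norm h x y"
  then obtain c where c: "c > 0" and Fc: "\<And>x y. x \<in> topspace M \<Longrightarrow> y \<in> tangent_space A x \<Longrightarrow>
      F x y = c * metric_norm h x y"
    by blast
  have h: "riemannian_metric M A h" using Z by (simp add: zermelo_data_def)
  have W: "W x = tzero" if x: "x \<in> topspace M" for x
  proof -
    note W = zermelo_data_at_point(2)[OF M Z x]
    show "W x = tzero"
      by (rule reversible_zermelo_solution_no_wind[OF M Z F x])
        (simp add: Fc[OF x] tangent_space_tscale[OF M W] W metric_norm_scale[OF M h x W])
  qed
  have "f x = 1 / c" if x: "x \<in> topspace M" for x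
  proof -
    obtain u where u: "u \<in> tangent_space A x" "metric_norm h x u = 1"
      using tangent_vector_of_length[OF M h x zero_less_one] by blast
    show ?thesis
      using zermelo_solution_no_wind[OF M Z F x W[OF x] u(1)] Fc[OF x u(1)] u(2) by simp
  qed
  with W show "(\<forall>x\<in>topspace M. W x = tzero) \<and> f constant_on topspace M"
    by (auto simp: constant_on_def)
next
  assume "(\<forall>x\<in>topspace M. W x = tzero) \<and> f constant_on topspace M"
  then obtain k where W: "\<And>x. x \<in> topspace M \<Longrightarrow> W x = tzero"
    and k: "\<And>x. x \<in> topspace M \<Longrightarrow> f x = k"
    by (auto simp: constant_on_def)
  \<comment> \<open>On the empty manifold \<open>k\<close> may be any real number, so \<open>1 / k\<close> need not be positive.\<close>
  show "\<exists>c>0. \<forall>x\<in>topspace M. \<forall>y\<in>tangent_space A x. F x y = c * metric_norm h x y"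
  proof (cases "topspace M = {}")
    case True
    then show ?thesis by (intro exI[of _ 1]) simp
  next
    case False
    then have "k > 0"
      using k zermelo_data_at_point(3)[OF M Z] by force
    then show ?thesis
      using zermelo_solution_no_wind[OF M Z F] W k by (intro exI[of _ "1 / k"]) simp
  qed
qed

lemma speed_constant_iff_norm_constant:
  assumes M: "smooth_manifold M A" and Z: "zermelo_data M A h W f"
  shows "f constant_on topspace M \<longleftrightarrow>
    (\<exists>k. \<forall>x\<in>topspace M. \<forall>u\<in>tangent_space A x. metric_norm h x u = f x \<longrightarrow> h x u u = k)"
proof -
  have sq: "h x u u = (f x)\<^sup>2"
    if x: "x \<in> topspace M" and "u \<in> tangent_space A x" "metric_norm h x u = f x" for x u
    using that(3) tangent_inner.nonneg[OF zermelo_data_at_point(1)[OF M Z x] that(2)]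
    by (simp add: metric_norm_def flip: that(3))
  show ?thesis
  proof
    assume "f constant_on topspace M"
    then obtain k where k: "\<And>x. x \<in> topspace M \<Longrightarrow> f x = k"
      by (auto simp: constant_on_def)
    show "\<exists>k. \<forall>x\<in>topspace M. \<forall>u\<in>tangent_space A x. metric_norm h x u = f x \<longrightarrow> h x u u = k"
    proof (intro exI ballI impI)
      fix x u
      assume x: "x \<in> topspace M" and u: "u \<in> tangent_space A x" "metric_norm h x u = f x"
      show "h x u u = k\<^sup>2"
        unfolding sq[OF x u] k[OF x] ..
    qed
  next
    assume "\<exists>k. \<forall>x\<in>topspace M. \<forall>u\<in>tangent_space A x. metric_norm h x u = f x \<longrightarrow> h x u u = k"
    then obtain k where
      k: "\<forall>x\<in>topspace M. \<forall>u\<in>tangent_space A x. metric_norm h x u = f x \<longrightarrow> h x u u = k"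
      by (rule exE)
    have h: "riemannian_metric M A h" using Z by (simp add: zermelo_data_def)
    have "f x = sqrt k" if x: "x \<in> topspace M" for x
    proof -
      note f = zermelo_data_at_point(3)[OF M Z x]
      obtain u where u: "u \<in> tangent_space A x" "metric_norm h x u = f x"
        using tangent_vector_of_length[OF M h x f] by blast
      show ?thesis using k[rule_format, OF x u] u(2) by (simp add: metric_norm_def)
    qed
    then show "f constant_on topspace M" by (auto simp: constant_on_def)
  qed
qed

section \<open>Characterization of the solution metrics\<close>

theorem proposition2p5:
  fixes M :: "'a topology" and A :: "('a, 'e::euclidean_space) chart set"
  assumes "smooth_manifold M A"
  shows
    "(\<forall>F. finsler_metric M A F \<and> strongly_convex A F \<longrightarrow>
        (is_randers M A F \<longleftrightarrow>
          (\<exists>h W f. zermelo_data M A h W f \<and> zermelo_solution M A h W f F)))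
     \<and>
     (\<forall>h W f F. zermelo_data M A h W f \<and> zermelo_solution M A h W f F \<longrightarrow>
        (is_riemannian M A F \<longleftrightarrow> (\<forall>x\<in>topspace M. W x = tzero)) \<and>
        (is_riemannian M A F \<longrightarrow>
          (\<exists>\<rho>. smooth_fun A \<rho> \<and> (\<forall>x\<in>topspace M. \<rho> x > 0 \<and>
             (\<forall>y\<in>tangent_space A x. F x y = \<rho> x * metric_norm h x y)))))
     \<and>
     (\<forall>h W f F. zermelo_data M A h W f \<and> zermelo_solution M A h W f F \<longrightarrow>
        ((\<exists>c>0. \<forall>x\<in>topspace M. \<forall>y\<in>tangent_space A x. F x y = c * metric_norm h x y)
           \<longleftrightarrow> (\<forall>x\<in>topspace M. W x = tzero) \<and> f constant_on topspace M) \<and>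
        (f constant_on topspace M \<longleftrightarrow>
           (\<exists>k. \<forall>x\<in>topspace M. \<forall>u\<in>tangent_space A x. metric_norm h x u = f x \<longrightarrow> h x u u = k)))"
proof (intro conjI allI impI; (elim conjE)?)
  note M = assms
  fix F assume "finsler_metric M A F"
  then have pos: "F x y > 0" if "x \<in> topspace M" "y \<in> tangent_space A x" "y \<noteq> tzero" for x y
    using that by (simp add: finsler_metric_def)
  show "is_randers M A F \<longleftrightarrow> (\<exists>h W f. zermelo_data M A h W f \<and> zermelo_solution M A h W f F)"
    using zermelo_solution_is_randers[OF M] positive_randers_is_zermelo_solution[OF M, of F] pos
    by blast
next
  note M = assms
  fix h W f F assume Z: "zermelo_data M A h W f" and F: "zermelo_solution M A h W f F"
  show riem: "is_riemannian M A F \<longleftrightarrow> (\<forall>x\<in>topspace M. W x = tzero)"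
    by (rule zermelo_solution_riemannian_iff_no_wind[OF M Z F])
  show "(\<exists>c>0. \<forall>x\<in>topspace M. \<forall>y\<in>tangent_space A x. F x y = c * metric_norm h x y)
      \<longleftrightarrow> (\<forall>x\<in>topspace M. W x = tzero) \<and> f constant_on topspace M"
    by (rule zermelo_solution_homothetic_iff[OF M Z F])
  show "f constant_on topspace M \<longleftrightarrow>
      (\<exists>k. \<forall>x\<in>topspace M. \<forall>u\<in>tangent_space A x. metric_norm h x u = f x \<longrightarrow> h x u u = k)"
    by (rule speed_constant_iff_norm_constant[OF M Z])
  assume "is_riemannian M A F"
  then have W: "W x = tzero" if "x \<in> topspace M" for x
    using riem that by blast
  have f_pos: "f x > 0" if "x \<in> topspace M" for x
    by (rule zermelo_data_at_point(3)[OF M Z that])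
  have "smooth_fun A (\<lambda>x. 1 / f x)"
    using Z by (intro smooth_fun_divide[OF M smooth_fun_const[OF M]])
      (auto simp: zermelo_data_def dest: f_pos)
  then show "\<exists>\<rho>. smooth_fun A \<rho> \<and> (\<forall>x\<in>topspace M. \<rho> x > 0 \<and>
      (\<forall>y\<in>tangent_space A x. F x y = \<rho> x * metric_norm h x y))"
    using f_pos zermelo_solution_no_wind[OF M Z F _ W] by (intro exI[of _ "\<lambda>x. 1 / f x"]) simp
qed

end
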